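(* Let $H_1,K_1,H_2,K_2$ be complex Hilbert spaces, each of dimension $\geq 2$, and let $M=B(H_1,K_1)$ and $N= B(H_2,K_2)$ be the corresponding type 1 Cartan factors. Let $\Phi : \mathcal{U}_{min}(M) \to \mathcal{U}_{min}(N)$ be a bijective transformation preserving triple transition pseudo-probabilities, i.e., $TTP(\Phi(v), \Phi(e))=\varphi_{\Phi(e)} (\Phi(v)) = \varphi_{e} (v) = TTP(v,e)$ for all $e,v\in \mathcal{U}_{min} (M)$. Then there exists a unique triple isomorphism $T: M \to N$ whose restriction to $\mathcal{U}_{min} (M)$ is $\Phi$.
   Context: For complex Hilbert spaces $H,K$, the type 1 Cartan factor $B(H,K)$ is the space of all bounded linear operators from $H$ to $K$ with the operator norm and the triple product $\{x,y,z\}=\frac12(xy^*z+zy^*x)$; it is a JBW$^*$-triple. A triple isomorphism is a complex-linear bijection $T$ with $T\{a,b,c\}=\{T(a),T(b),T(c)\}$ for all $a,b,c$. A tripotent in $M$ is an element $e$ with $\{e,e,e\}=e$ (here: a partial isometry). For a tripotent $e$, $M=M_0(e)\oplus M_1(e)\oplus M_2(e)$ where $M_k(e)=\{x\in M: \{e,e,x\}=\frac{k}{2}x\}$; the corresponding projection onto $M_k(e)$ is denoted $P_k(e)$. A tripotent $e$ is minimal if $M_2(e)=\mathbb{C}e\neq\{0\}$ (here: a rank-one partial isometry). $\mathcal{U}_{min}(M)$ denotes the set of minimal tripotents of $M$. For each minimal tripotent $e$ in a JBW$^*$-triple $M$ there is a unique extreme point $\varphi_e$ of the closed unit ball of the predual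 $M_*$ with $P_2(e)(x)=\varphi_e(x)e$ for all $x\in M$. For minimal tripotents $e,v$ in $M$, the triple transition pseudo-probability from $e$ to $v$ is the complex number $TTP(e,v)=\varphi_v(e)$. *)

theory Defs
  imports "HOL-Analysis.Analysis"
begin

section \<open>Complex normed spaces and complex Hilbert spaces\<close>

class scaleC =
  fixes scaleC :: "complex \<Rightarrow> 'a \<Rightarrow> 'a"  (infixr \<open>*\<^sub>C\<close> 75)

class complex_vector = real_vector + scaleC +
  assumes scaleC_add_right: "a *\<^sub>C (x + y) = a *\<^sub>C x + a *\<^sub>C y"
    and scaleC_add_left: "(a + b) *\<^sub>C x = a *\<^sub>C x + b *\<^sub>C x"
    and scaleC_scaleC: "a *\<^sub>C (b *\<^sub>C x) = (a * b) *\<^sub>C x"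
    and scaleC_one: "1 *\<^sub>C x = x"
    and scaleR_eq_scaleC: "r *\<^sub>R x = complex_of_real r *\<^sub>C x"

interpretation complex_vector: vector_space "scaleC :: complex \<Rightarrow> 'a \<Rightarrow> 'a::complex_vector"
  by unfold_locales
    (simp_all add: scaleC_add_right scaleC_add_left scaleC_scaleC scaleC_one)

class complex_normed_vector = complex_vector + real_normed_vector +
  assumes norm_scaleC: "norm (a *\<^sub>C x) = cmod a * norm x"

text \<open>The inner product is linear in the first argument. Positive definiteness is contained in
  \<open>cinner_self\<close>, which says that the norm is the one induced by the inner product.\<close>

class complex_inner = complex_normed_vector +
  fixes cinner :: "'a \<Rightarrow> 'a \<Rightarrow> complex"
  assumes cinner_commute: "cinner x y = cnj (cinner y x)"
    and cinner_add_left: "cinner (x + y) z = cinner x z + cinner y z"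
    and cinner_scaleC_left: "cinner (a *\<^sub>C x) y = a * cinner x y"
    and cinner_self: "cinner x x = complex_of_real ((norm x)\<^sup>2)"

class chilbert_space = complex_inner + complete_space

instantiation complex :: chilbert_space
begin

definition scaleC_complex :: "complex \<Rightarrow> complex \<Rightarrow> complex"
  where "scaleC_complex a x = a * x"

definition cinner_complex :: "complex \<Rightarrow> complex \<Rightarrow> complex"
  where "cinner_complex x y = x * cnj y"

instance
proof
  fix x :: complex
  show "cinner x x = complex_of_real ((norm x)\<^sup>2)"
    unfolding cinner_complex_def by (metis complex_norm_square)
qed (auto simp: scaleC_complex_def cinner_complex_def algebra_simps scaleR_conv_of_real norm_mult)

end

text \<open>Complex dimension at least \<open>n\<close>. For a Hilbert space and finite \<open>n\<close> it makes no difference whether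
  one counts linearly independent or orthonormal vectors. (The constant \<open>vector_space.dim\<close> is
  not used since it has the value 0 on infinite-dimensional spaces.)\<close>

definition cdim_at_least :: "nat \<Rightarrow> 'a::complex_vector itself \<Rightarrow> bool"
  where "cdim_at_least n (_ :: 'a itself) \<longleftrightarrow>
    (\<exists>B :: 'a set. finite B \<and> card B = n \<and> complex_vector.independent B)"


section \<open>Bounded complex-linear operators\<close>

text \<open>The norm, the metric and the real vector space structure are those of the type of bounded
  real-linear operators, so the norm is the operator norm.\<close>

typedef (overloaded) ('a, 'b) cblinfun (\<open>(_ \<Rightarrow>\<^sub>C\<^sub>L /_)\<close> [22, 21] 21) =
  "{f :: 'a::complex_normed_vector \<Rightarrow>\<^sub>L 'b::complex_normed_vector.
      \<forall>c x. blinfun_apply f (c *\<^sub>C x) = c *\<^sub>C blinfun_apply f x}"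
  by (rule exI[of _ 0]) simp

setup_lifting type_definition_cblinfun

lift_definition cblinfun_apply ::
  "('a::complex_normed_vector \<Rightarrow>\<^sub>C\<^sub>L 'b::complex_normed_vector) \<Rightarrow> 'a \<Rightarrow> 'b"
  (infixr \<open>*\<^sub>V\<close> 90)
  is blinfun_apply .

instantiation cblinfun :: (complex_normed_vector, complex_normed_vector) complex_normed_vector
begin

lift_definition zero_cblinfun :: "'a \<Rightarrow>\<^sub>C\<^sub>L 'b" is 0 by simp

lift_definition plus_cblinfun :: "('a \<Rightarrow>\<^sub>C\<^sub>L 'b) \<Rightarrow> ('a \<Rightarrow>\<^sub>C\<^sub>L 'b) \<Rightarrow> 'a \<Rightarrow>\<^sub>C\<^sub>L 'b" is "(+)"
  by (simp add: blinfun.add_left scaleC_add_right)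

lift_definition minus_cblinfun :: "('a \<Rightarrow>\<^sub>C\<^sub>L 'b) \<Rightarrow> ('a \<Rightarrow>\<^sub>C\<^sub>L 'b) \<Rightarrow> 'a \<Rightarrow>\<^sub>C\<^sub>L 'b" is "(-)"
  by (simp add: blinfun.diff_left complex_vector.scale_right_diff_distrib)

lift_definition uminus_cblinfun :: "('a \<Rightarrow>\<^sub>C\<^sub>L 'b) \<Rightarrow> 'a \<Rightarrow>\<^sub>C\<^sub>L 'b" is uminus
  by (simp add: blinfun.minus_left)

lift_definition scaleR_cblinfun :: "real \<Rightarrow> ('a \<Rightarrow>\<^sub>C\<^sub>L 'b) \<Rightarrow> 'a \<Rightarrow>\<^sub>C\<^sub>L 'b" is scaleR
  by (simp add: blinfun.scaleR_left scaleR_eq_scaleC mult.commute)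

lemma bounded_linear_scaleC_right: "bounded_linear (\<lambda>x::'c::complex_normed_vector. c *\<^sub>C x)"
  by (rule bounded_linear_intro[where K = "cmod c"])
    (simp_all add: scaleC_add_right scaleR_eq_scaleC norm_scaleC mult.commute)

lift_definition scaleC_cblinfun :: "complex \<Rightarrow> ('a \<Rightarrow>\<^sub>C\<^sub>L 'b) \<Rightarrow> 'a \<Rightarrow>\<^sub>C\<^sub>L 'b"
  is "\<lambda>c f. Blinfun (\<lambda>x. c *\<^sub>C blinfun_apply f x)"
  by (subst (1 2) bounded_linear_Blinfun_apply)
    (auto intro!: bounded_linear_compose[OF bounded_linear_scaleC_right] blinfun.bounded_linear_right
      simp: mult.commute)

lift_definition norm_cblinfun :: "('a \<Rightarrow>\<^sub>C\<^sub>L 'b) \<Rightarrow> real" is norm .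

lift_definition dist_cblinfun :: "('a \<Rightarrow>\<^sub>C\<^sub>L 'b) \<Rightarrow> ('a \<Rightarrow>\<^sub>C\<^sub>L 'b) \<Rightarrow> real" is dist .

definition sgn_cblinfun :: "('a \<Rightarrow>\<^sub>C\<^sub>L 'b) \<Rightarrow> 'a \<Rightarrow>\<^sub>C\<^sub>L 'b"
  where "sgn_cblinfun f = inverse (norm f) *\<^sub>R f"

definition uniformity_cblinfun :: "(('a \<Rightarrow>\<^sub>C\<^sub>L 'b) \<times> ('a \<Rightarrow>\<^sub>C\<^sub>L 'b)) filter"
  where "uniformity_cblinfun = (INF e\<in>{0<..}. principal {(x, y). dist x y < e})"

definition open_cblinfun :: "('a \<Rightarrow>\<^sub>C\<^sub>L 'b) set \<Rightarrow> bool"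
  where "open_cblinfun U \<longleftrightarrow> (\<forall>x\<in>U. \<forall>\<^sub>F (x', y) in uniformity. x' = x \<longrightarrow> y \<in> U)"

lemma blinfun_apply_scaleC_Blinfun:
  "blinfun_apply (Blinfun (\<lambda>x. c *\<^sub>C blinfun_apply f x)) x
    = c *\<^sub>C blinfun_apply (f :: 'c::complex_normed_vector \<Rightarrow>\<^sub>L 'd::complex_normed_vector) x"
  by (subst bounded_linear_Blinfun_apply)
    (auto intro!: bounded_linear_compose[OF bounded_linear_scaleC_right] blinfun.bounded_linear_right)

lemma cblinfun_eqI: "(\<And>x. f *\<^sub>V x = g *\<^sub>V x) \<Longrightarrow> f = g"
  for f g :: "'c::complex_normed_vector \<Rightarrow>\<^sub>C\<^sub>L 'd::complex_normed_vector"
  by transfer (rule blinfun_eqI)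

lemma cblinfun_apply_add: "(f + g) *\<^sub>V x = f *\<^sub>V x + g *\<^sub>V x"
  by transfer (rule blinfun.add_left)

lemma cblinfun_apply_scaleR: "(r *\<^sub>R f) *\<^sub>V x = r *\<^sub>R (f *\<^sub>V x)"
  by transfer (rule blinfun.scaleR_left)

lemma cblinfun_apply_scaleC: "(c *\<^sub>C f) *\<^sub>V x = c *\<^sub>C (f *\<^sub>V x)"
  by transfer (rule blinfun_apply_scaleC_Blinfun)

instance
proof
  fix f g h :: "'a \<Rightarrow>\<^sub>C\<^sub>L 'b" and a b :: complex and r s :: real
  show "f + g + h = f + (g + h)" by transfer simp
  show "f + g = g + f" by transfer simp
  show "0 + f = f" by transfer simp
  show "- f + f = 0" by transfer simp
  show "f - g = f + - g" by transfer simp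
  show "r *\<^sub>R (f + g) = r *\<^sub>R f + r *\<^sub>R g" by transfer (simp add: scaleR_add_right)
  show "(r + s) *\<^sub>R f = r *\<^sub>R f + s *\<^sub>R f" by transfer (simp add: scaleR_add_left)
  show "r *\<^sub>R s *\<^sub>R f = (r * s) *\<^sub>R f" by transfer simp
  show "1 *\<^sub>R f = f" by transfer simp
  show "a *\<^sub>C (f + g) = a *\<^sub>C f + a *\<^sub>C g"
    by (rule cblinfun_eqI) (simp add: cblinfun_apply_add cblinfun_apply_scaleC scaleC_add_right)
  show "(a + b) *\<^sub>C f = a *\<^sub>C f + b *\<^sub>C f"
    by (rule cblinfun_eqI) (simp add: cblinfun_apply_add cblinfun_apply_scaleC scaleC_add_left)
  show "a *\<^sub>C b *\<^sub>C f = (a * b) *\<^sub>C f"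
    by (rule cblinfun_eqI) (simp add: cblinfun_apply_scaleC)
  show "1 *\<^sub>C f = f"
    by (rule cblinfun_eqI) (simp add: cblinfun_apply_scaleC)
  show "r *\<^sub>R f = complex_of_real r *\<^sub>C f"
    by (rule cblinfun_eqI) (simp add: cblinfun_apply_scaleC cblinfun_apply_scaleR scaleR_eq_scaleC)
  show "dist f g = norm (f - g)" by transfer (rule dist_norm)
  show "sgn f = inverse (norm f) *\<^sub>R f" by (rule sgn_cblinfun_def)
  show "norm f = 0 \<longleftrightarrow> f = 0" by transfer simp
  show "norm (f + g) \<le> norm f + norm g" by transfer (rule norm_triangle_ineq)
  show "norm (r *\<^sub>R f) = \<bar>r\<bar> * norm f" by transfer simp
  show "norm (a *\<^sub>C f) = cmod a * norm f"
  proof transfer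
    fix a :: complex and f :: "'a \<Rightarrow>\<^sub>L 'b"
    have "norm (Blinfun (\<lambda>x. a *\<^sub>C blinfun_apply f x)) = onorm (\<lambda>x. a *\<^sub>C blinfun_apply f x)"
      unfolding norm_blinfun.rep_eq ext[OF blinfun_apply_scaleC_Blinfun] ..
    also have "\<dots> = onorm (\<lambda>x. cmod a *\<^sub>R blinfun_apply f x)"
      by (simp add: onorm_def norm_scaleC)
    also have "\<dots> = cmod a * norm f"
      by (simp add: onorm_scaleR blinfun.bounded_linear_right norm_blinfun.rep_eq)
    finally show "norm (Blinfun (\<lambda>x. a *\<^sub>C blinfun_apply f x)) = cmod a * norm f" .
  qed
qed (rule uniformity_cblinfun_def open_cblinfun_def)+

end

lift_definition cblinfun_compose ::
  "('b::complex_normed_vector \<Rightarrow>\<^sub>C\<^sub>L 'c::complex_normed_vector) \<Rightarrow>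
   ('a::complex_normed_vector \<Rightarrow>\<^sub>C\<^sub>L 'b) \<Rightarrow> ('a \<Rightarrow>\<^sub>C\<^sub>L 'c)"  (infixl \<open>o\<^sub>C\<^sub>L\<close> 67)
  is "(o\<^sub>L)"
  by simp

definition adj ::
  "('a::chilbert_space \<Rightarrow>\<^sub>C\<^sub>L 'b::chilbert_space) \<Rightarrow> ('b \<Rightarrow>\<^sub>C\<^sub>L 'a)"
  where "adj f = (THE g. \<forall>x y. cinner (f *\<^sub>V x) y = cinner x (g *\<^sub>V y))"


section \<open>The JBW*-triple of bounded operators between two Hilbert spaces\<close>

definition triple ::
  "('h::chilbert_space \<Rightarrow>\<^sub>C\<^sub>L 'k::chilbert_space) \<Rightarrow> ('h \<Rightarrow>\<^sub>C\<^sub>L 'k) \<Rightarrow> ('h \<Rightarrow>\<^sub>C\<^sub>L 'k) \<Rightarrow> ('h \<Rightarrow>\<^sub>C\<^sub>L 'k)"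
  where "triple x y z = (1/2) *\<^sub>C (x o\<^sub>C\<^sub>L adj y o\<^sub>C\<^sub>L z + z o\<^sub>C\<^sub>L adj y o\<^sub>C\<^sub>L x)"

definition triple_isomorphism ::
  "(('h1::chilbert_space \<Rightarrow>\<^sub>C\<^sub>L 'k1::chilbert_space) \<Rightarrow>
    ('h2::chilbert_space \<Rightarrow>\<^sub>C\<^sub>L 'k2::chilbert_space)) \<Rightarrow> bool"
  where "triple_isomorphism T \<longleftrightarrow>
    Vector_Spaces.linear scaleC scaleC T \<and> bij T \<and>
    (\<forall>a b c. T (triple a b c) = triple (T a) (T b) (T c))"

definition tripotent :: "('h::chilbert_space \<Rightarrow>\<^sub>C\<^sub>L 'k::chilbert_space) \<Rightarrow> bool"
  where "tripotent e \<longleftrightarrow> triple e e e = e"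

definition peirce_space ::
  "nat \<Rightarrow> ('h::chilbert_space \<Rightarrow>\<^sub>C\<^sub>L 'k::chilbert_space) \<Rightarrow> ('h \<Rightarrow>\<^sub>C\<^sub>L 'k) set"
  where "peirce_space k e = {x. triple e e x = (of_nat k / 2) *\<^sub>C x}"

text \<open>The projection onto \<open>peirce_space 2 e\<close> along the other two summands of the Peirce decomposition.\<close>

definition peirce_proj2 ::
  "('h::chilbert_space \<Rightarrow>\<^sub>C\<^sub>L 'k::chilbert_space) \<Rightarrow> ('h \<Rightarrow>\<^sub>C\<^sub>L 'k) \<Rightarrow> ('h \<Rightarrow>\<^sub>C\<^sub>L 'k)"
  where "peirce_proj2 e x = (THE x2. x2 \<in> peirce_space 2 e \<and>
    (\<exists>x0 \<in> peirce_space 0 e. \<exists>x1 \<in> peirce_space 1 e. x = x0 + x1 + x2))"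

definition minimal_tripotents :: "('h::chilbert_space \<Rightarrow>\<^sub>C\<^sub>L 'k::chilbert_space) set"
  where "minimal_tripotents =
    {e. tripotent e \<and> peirce_space 2 e = range (\<lambda>c. c *\<^sub>C e) \<and> peirce_space 2 e \<noteq> {0}}"

text \<open>The predual of the space of bounded operators from \<open>'h\<close> to \<open>'k\<close>, realised as usual inside the
  Banach dual (with the dual norm) as the set of ultraweakly continuous functionals, that is, the
  functionals given by trace-class operators.\<close>

definition predual :: "(('h::chilbert_space \<Rightarrow>\<^sub>C\<^sub>L 'k::chilbert_space) \<Rightarrow>\<^sub>C\<^sub>L complex) set"
  where "predual = {\<phi>. \<exists>(\<xi> :: nat \<Rightarrow> 'h) (\<eta> :: nat \<Rightarrow> 'k).
    summable (\<lambda>n. (norm (\<xi> n))\<^sup>2) \<and> summable (\<lambda>n. (norm (\<eta> n))\<^sup>2) \<and>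
    (\<forall>x. \<phi> *\<^sub>V x = (\<Sum>n. cinner (x *\<^sub>V \<xi> n) (\<eta> n)))}"

definition support_functional ::
  "('h::chilbert_space \<Rightarrow>\<^sub>C\<^sub>L 'k::chilbert_space) \<Rightarrow> (('h \<Rightarrow>\<^sub>C\<^sub>L 'k) \<Rightarrow>\<^sub>C\<^sub>L complex)"
  where "support_functional e = (THE \<phi>.
    \<phi> extreme_point_of {\<psi> \<in> predual. norm \<psi> \<le> 1} \<and>
    (\<forall>x. peirce_proj2 e x = (\<phi> *\<^sub>V x) *\<^sub>C e))"

text \<open>The triple transition pseudo-probability from \<open>e\<close> to \<open>v\<close>.\<close>

definition TTP ::
  "('h::chilbert_space \<Rightarrow>\<^sub>C\<^sub>L 'k::chilbert_space) \<Rightarrow> ('h \<Rightarrow>\<^sub>C\<^sub>L 'k) \<Rightarrow> complex"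
  where "TTP e v = support_functional v *\<^sub>V e"

end

theory Submission
  imports Defs
begin

text \<open>The minimal tripotents are the operators \<open>k \<otimes> h = \<langle>\<cdot>, h\<rangle> k\<close> with unit vectors \<open>k\<close>, \<open>h\<close>, and
  \<open>TTP (k \<otimes> h) (k' \<otimes> h') = \<langle>k, k'\<rangle> \<langle>h', h\<rangle>\<close> is their Hilbert--Schmidt inner product. As these
  functionals separate the bounded operators and \<open>\<Phi>\<close> is onto, the homogeneous extension of \<open>\<Phi>\<close> to
  all \<open>k \<otimes> h\<close> is sesquilinear in \<open>(k, h)\<close>. A sum of two operators of rank one has rank at most one
  only if their ranges or their coranges agree, and this relation is preserved in both directions.
  Hence either \<open>\<Phi> (k \<otimes> h) = g k \<otimes> f h\<close> with unitary \<open>f\<close>, \<open>g\<close>, and \<open>T x = g x f\<^sup>*\<close>, or the same holds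
  for the adjoints of the values of \<open>\<Phi>\<close> with antiunitary \<open>f\<close>, \<open>g\<close>, and \<open>T x = (g x f\<^sup>*)\<^sup>*\<close>. Uniqueness
  follows from the fact that the triple product \<open>{e, x, e}\<close> recovers \<open>\<phi>\<^sub>e x\<close>.\<close>

section \<open>Inner products and the Riesz representation\<close>

lemma cinner_add_right: "cinner x (y + z) = cinner x y + cinner x z"
  by (subst (1 2 3) cinner_commute) (simp add: cinner_add_left)

lemma cinner_scaleC_right: "cinner x (a *\<^sub>C y) = cnj a * cinner x y"
  by (subst (1 2) cinner_commute) (simp add: cinner_scaleC_left)

lemma scaleC_minus_one: "(- 1) *\<^sub>C x = - (x :: 'a::complex_vector)"
  using complex_vector.scale_minus_left[of 1 x] by (simp add: scaleC_one)

lemma cinner_minus_left: "cinner (- x) y = - cinner x y"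
  using cinner_scaleC_left[of "- 1" x y] by (simp add: scaleC_minus_one)

lemma cinner_minus_right: "cinner x (- y) = - cinner x y"
  using cinner_scaleC_right[of x "- 1" y] by (simp add: scaleC_minus_one)

lemma cinner_diff_left: "cinner (x - y) z = cinner x z - cinner y z"
  using cinner_add_left[of x "- y" z] by (simp add: cinner_minus_left)

lemma cinner_diff_right: "cinner x (y - z) = cinner x y - cinner x z"
  using cinner_add_right[of x y "- z"] by (simp add: cinner_minus_right)

lemma cinner_zero_left [simp]: "cinner 0 y = 0"
  using cinner_diff_left[of 0 0 y] by simp

lemma cinner_zero_right [simp]: "cinner x 0 = 0"
  using cinner_diff_right[of x 0 0] by simp

lemmas cinner_simps = cinner_add_left cinner_add_right cinner_diff_left cinner_diff_right
  cinner_scaleC_left cinner_scaleC_right cinner_minus_left cinner_minus_right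

lemma cinner_self_eq_0: "cinner x x = 0 \<longleftrightarrow> x = 0"
  by (simp add: cinner_self)

lemma cinner_eqI_right: "x = y" if "\<And>z. cinner z x = cinner z y"
  using that[of "x - y"] cinner_self_eq_0[of "x - y"] by (simp add: cinner_diff_right)

lemma cinner_eqI_left: "x = y" if "\<And>z. cinner x z = cinner y z"
  using that[of "x - y"] cinner_self_eq_0[of "x - y"] by (simp add: cinner_diff_left)

section \<open>Norm identities and the Cauchy-Schwarz inequality\<close>

lemma norm_sq_add:
  "(norm (x + y))\<^sup>2 = (norm x)\<^sup>2 + (norm y)\<^sup>2 + 2 * Re (cinner x y)"
  for x y :: "'a::complex_inner"
proof -
  have "complex_of_real ((norm (x + y))\<^sup>2) = cinner (x + y) (x + y)"
    by (simp add: cinner_self)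
  also have "\<dots> = cinner x x + cinner y y + (cinner x y + cnj (cinner x y))"
    using cinner_commute[of y x] by (simp add: cinner_simps)
  also have "\<dots> = complex_of_real ((norm x)\<^sup>2 + (norm y)\<^sup>2 + 2 * Re (cinner x y))"
    by (simp add: cinner_self complex_add_cnj)
  finally show ?thesis
    using of_real_eq_iff by blast
qed

text \<open>The remainder is orthogonal to \<open>h\<close>. Dropping it gives Cauchy-Schwarz;
  keeping it measures how much a vector shrinks when its component along \<open>h\<close> is
  removed.\<close>

lemma pythagoras_component:
  assumes "norm h = 1"
  shows "(norm v)\<^sup>2 = (cmod (cinner v h))\<^sup>2 + (norm (v - cinner v h *\<^sub>C h))\<^sup>2"
proof -
  let ?w = "v - cinner v h *\<^sub>C h"
  have "cinner h h = 1" using assms by (simp add: cinner_self)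
  then have "cinner (cinner v h *\<^sub>C h) ?w = 0"
    using cinner_commute[of h v] by (simp add: cinner_simps)
  then show ?thesis
    using norm_sq_add[of "cinner v h *\<^sub>C h" ?w] assms by (simp add: norm_scaleC)
qed

lemma cinner_sgn: "cinner (sgn x) y = cinner x y / norm x"
  by (simp add: sgn_div_norm scaleR_eq_scaleC cinner_scaleC_left divide_inverse mult.commute)

lemma cauchy_schwarz: "cmod (cinner x y) \<le> norm x * norm y"
proof (cases "y = 0")
  case False
  then have n: "norm (sgn y) = 1" by (simp add: norm_sgn)
  have "(cmod (cinner x (sgn y)))\<^sup>2 \<le> (norm x)\<^sup>2"
    using pythagoras_component[OF n, of x] by simp
  then have "cmod (cinner x (sgn y)) \<le> norm x"
    by (simp add: abs_le_square_iff[symmetric])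
  moreover have "cmod (cinner x (sgn y)) = cmod (cinner x y) / norm y"
    using cinner_commute[of x "sgn y"] cinner_commute[of x y] by (simp add: cinner_sgn norm_divide)
  ultimately show ?thesis
    using False by (simp add: divide_le_eq)
qed simp

section \<open>The Riesz representation theorem\<close>

lemma additive_scaleR_of_scaleC:
  fixes f :: "'a::complex_vector \<Rightarrow> 'b::complex_vector"
  assumes "\<And>a x. f (a *\<^sub>C x) = a *\<^sub>C f x"
  shows "f (r *\<^sub>R x) = r *\<^sub>R f x"
  by (simp add: scaleR_eq_scaleC assms)

text \<open>The vector of least norm in the affine hyperplane where \<open>\<phi>\<close> is 1 is
  orthogonal to the kernel of \<open>\<phi>\<close>, and a multiple of it represents
  \<open>\<phi>\<close>. It is found as the limit of a minimizing sequence.\<close>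

lemma riesz_representation:
  fixes \<phi> :: "'a::chilbert_space \<Rightarrow> complex"
  assumes add: "\<And>x y. \<phi> (x + y) = \<phi> x + \<phi> y"
    and scale: "\<And>a x. \<phi> (a *\<^sub>C x) = a * \<phi> x"
    and bound: "\<And>x. cmod (\<phi> x) \<le> B * norm x"
  shows "\<exists>y. \<forall>x. \<phi> x = cinner x y"
proof (cases "\<forall>x. \<phi> x = 0")
  case True
  then show ?thesis by (intro exI[of _ 0]) simp
next
  case False
  then obtain x0 where x0: "\<phi> x0 \<noteq> 0" by blast
  have diff: "\<phi> (x - y) = \<phi> x - \<phi> y" for x y
    using add[of x "- y"] scale[of "- 1" y] by (simp add: scaleC_minus_one)
  have bl: "bounded_linear \<phi>"
  proof (rule bounded_linear_intro[where K = B])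
    show "\<phi> (r *\<^sub>R x) = r *\<^sub>R \<phi> x" for r x
      by (simp add: scaleR_eq_scaleC scale scaleC_complex_def)
    show "norm (\<phi> x) \<le> norm x * B" for x
      using bound[of x] by (simp add: mult.commute)
  qed (rule add)
  define N where "N = (\<lambda>x. (norm x)\<^sup>2) ` {x. \<phi> x = 1}"
  define d where "d = Inf N"
  have "inverse (\<phi> x0) *\<^sub>C x0 \<in> {x. \<phi> x = 1}" using x0 by (simp add: scale)
  then have ne: "N \<noteq> {}" unfolding N_def by blast
  have bdd: "bdd_below N" unfolding N_def by (intro bdd_belowI[of _ 0]) auto
  have lower: "d \<le> (norm x)\<^sup>2" if "\<phi> x = 1" for x
    unfolding d_def by (rule cInf_lower[OF _ bdd]) (use that in \<open>auto simp: N_def\<close>)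
  have "\<exists>x. \<phi> x = 1 \<and> (norm x)\<^sup>2 < d + inverse (real (Suc n))" for n
    using cInf_lessD[OF ne, of "d + inverse (real (Suc n))"] unfolding d_def N_def by auto
  then obtain X where X1: "\<And>n. \<phi> (X n) = 1"
    and Xn: "\<And>n. (norm (X n))\<^sup>2 < d + inverse (real (Suc n))" by metis
  \<comment> \<open>The midpoint of \<open>X m\<close> and \<open>X n\<close> stays in the
    hyperplane, so its squared norm is at least \<open>d\<close>; the parallelogram law turns this
    into a bound on the difference.\<close>
  have close: "(norm (X m - X n))\<^sup>2 \<le> 2 * inverse (real (Suc m)) + 2 * inverse (real (Suc n))"
    for m n
  proof -
    have "\<phi> ((1/2) *\<^sub>C (X m + X n)) = 1" by (simp add: scale add X1)
    from lower[OF this] have "4 * d \<le> (norm (X m + X n))\<^sup>2"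
      by (simp add: norm_scaleC power_divide norm_divide)
    moreover have "(norm (X m + X n))\<^sup>2 + (norm (X m - X n))\<^sup>2
        = 2 * (norm (X m))\<^sup>2 + 2 * (norm (X n))\<^sup>2"
      using norm_sq_add[of "X m" "X n"] norm_sq_add[of "X m" "- X n"]
      by (simp add: cinner_minus_right)
    ultimately show ?thesis using Xn[of m] Xn[of n] by linarith
  qed
  have "Cauchy X"
  proof (rule metric_CauchyI)
    fix e :: real assume e: "0 < e"
    then obtain M where M: "inverse (real (Suc M)) < e\<^sup>2 / 4"
      using reals_Archimedean[of "e\<^sup>2 / 4"] by auto
    have "dist (X m) (X n) < e" if "M \<le> m" "M \<le> n" for m n
    proof -
      have "inverse (real (Suc m)) \<le> inverse (real (Suc M))"
        "inverse (real (Suc n)) \<le> inverse (real (Suc M))"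
        using that by simp_all
      then have "(norm (X m - X n))\<^sup>2 < e\<^sup>2" using close[of m n] M by linarith
      then show ?thesis using e by (simp add: dist_norm power_less_imp_less_base)
    qed
    then show "\<exists>M. \<forall>m\<ge>M. \<forall>n\<ge>M. dist (X m) (X n) < e" by blast
  qed
  then obtain z where z: "X \<longlonglongrightarrow> z"
    using Cauchy_convergent convergent_def by blast
  have "(\<lambda>n. \<phi> (X n)) \<longlonglongrightarrow> \<phi> z" by (rule bounded_linear.tendsto[OF bl z])
  then have \<phi>z: "\<phi> z = 1" by (simp add: X1 LIMSEQ_const_iff)
  have "(\<lambda>n. (norm (X n))\<^sup>2) \<longlonglongrightarrow> (norm z)\<^sup>2" by (intro tendsto_intros z)
  moreover have "(\<lambda>n. d + inverse (real (Suc n))) \<longlonglongrightarrow> d"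
    using tendsto_add[OF tendsto_const LIMSEQ_inverse_real_of_nat, of d] by simp
  ultimately have zd: "(norm z)\<^sup>2 \<le> d"
    by (rule LIMSEQ_le) (use Xn in \<open>auto intro: less_imp_le\<close>)
  \<comment> \<open>Removing from \<open>z\<close> its component along a unit vector
    \<open>u\<close> of the kernel keeps \<open>z\<close> in the hyperplane, so minimality forces
    this component to vanish.\<close>
  have orth: "cinner w z = 0" if "\<phi> w = 0" for w
  proof (cases "w = 0")
    case False
    define u where "u = sgn w"
    have u: "norm u = 1" "\<phi> u = 0"
      using False that by (simp add: u_def norm_sgn) (simp add: u_def sgn_div_norm scaleR_eq_scaleC scale that)
    have "\<phi> (z - cinner z u *\<^sub>C u) = 1" by (simp add: diff scale u \<phi>z)
    from lower[OF this] have "(cmod (cinner z u))\<^sup>2 \<le> 0"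
      using pythagoras_component[OF u(1), of z] zd by linarith
    then have "cinner z u = 0" by simp
    then have "cinner u z = 0" using cinner_commute[of u z] by simp
    then show ?thesis using False by (simp add: u_def cinner_sgn)
  qed simp
  have "z \<noteq> 0" using \<phi>z scale[of 0 z] by (auto simp: complex_vector.scale_zero_left)
  \<comment> \<open>The scalar comes from splitting \<open>x\<close> into a kernel vector and
    \<open>\<phi> x\<close> times \<open>z\<close>.\<close>
  have "\<phi> x = cinner x (inverse (complex_of_real ((norm z)\<^sup>2)) *\<^sub>C z)" for x
  proof -
    have "\<phi> (x - \<phi> x *\<^sub>C z) = 0" by (simp add: diff scale \<phi>z)
    from orth[OF this] have "cinner x z = \<phi> x * (norm z)\<^sup>2"
      by (simp add: cinner_simps cinner_self)
    then show ?thesis using \<open>z \<noteq> 0\<close> by (simp add: cinner_scaleC_right)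
  qed
  then show ?thesis by blast
qed


section \<open>Bounded operators, adjoints and operators of rank one\<close>

lemma bounded_linear_imp_cblinfun:
  fixes f :: "'a::complex_normed_vector \<Rightarrow> 'b::complex_normed_vector"
  assumes add: "\<And>x y. f (x + y) = f x + f y"
    and scale: "\<And>a x. f (a *\<^sub>C x) = a *\<^sub>C f x"
    and bound: "\<And>x. norm (f x) \<le> B * norm x"
  shows "\<exists>F. \<forall>x. F *\<^sub>V x = f x"
proof -
  have "bounded_linear f"
    by (rule bounded_linear_intro[where K = B])
      (use bound in \<open>simp_all add: add scale additive_scaleR_of_scaleC mult.commute\<close>)
  then have ap: "blinfun_apply (Blinfun f) = f" by (rule bounded_linear_Blinfun_apply)
  have "cblinfun_apply (Abs_cblinfun (Blinfun f)) = f"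
    unfolding cblinfun_apply.rep_eq by (subst Abs_cblinfun_inverse) (simp_all add: ap scale)
  then show ?thesis by metis
qed

lemma cblinfun_apply_add_right: "f *\<^sub>V (x + y) = f *\<^sub>V x + f *\<^sub>V y"
  by transfer (rule blinfun.add_right)

lemma cblinfun_apply_diff_right: "f *\<^sub>V (x - y) = f *\<^sub>V x - f *\<^sub>V y"
  by transfer (rule blinfun.diff_right)

lemma cblinfun_apply_scaleC_right: "f *\<^sub>V (c *\<^sub>C x) = c *\<^sub>C (f *\<^sub>V x)"
  by transfer simp

lemma cblinfun_apply_diff: "(f - g) *\<^sub>V x = f *\<^sub>V x - g *\<^sub>V x"
  by transfer (rule blinfun.diff_left)

lemma cblinfun_apply_zero [simp]: "0 *\<^sub>V x = 0"
  by transfer simp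

lemma cblinfun_apply_zero_right [simp]: "f *\<^sub>V 0 = 0"
  by transfer simp

lemma cblinfun_apply_compose [simp]: "(f o\<^sub>C\<^sub>L g) *\<^sub>V x = f *\<^sub>V (g *\<^sub>V x)"
  by transfer simp

lemmas cblinfun_simps = cblinfun_apply_add cblinfun_apply_add_right cblinfun_apply_diff
  cblinfun_apply_diff_right cblinfun_apply_scaleC cblinfun_apply_scaleC_right
  cblinfun_apply_scaleR

section \<open>Operator norm estimates and adjoints\<close>

lemma norm_cblinfun_apply: "norm (f *\<^sub>V x) \<le> norm f * norm x"
  by transfer (rule norm_blinfun)

lemma norm_cblinfun_bound:
  assumes "0 \<le> b" "\<And>x. norm (f *\<^sub>V x) \<le> b * norm x"
  shows "norm f \<le> b"
  using assms by transfer (rule norm_blinfun_bound)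

text \<open>This justifies the definite description in \<open>adj\<close>: Riesz provides the value
  at each \<open>y\<close>, and these values depend linearly and boundedly on
  \<open>y\<close>.\<close>

lemma cinner_adj:
  fixes f :: "'a::chilbert_space \<Rightarrow>\<^sub>C\<^sub>L 'b::chilbert_space"
  shows "cinner (f *\<^sub>V x) y = cinner x (adj f *\<^sub>V y)"
proof -
  have "\<exists>z. \<forall>x. cinner (f *\<^sub>V x) y = cinner x z" for y
  proof (rule riesz_representation)
    fix x
    have "cmod (cinner (f *\<^sub>V x) y) \<le> norm (f *\<^sub>V x) * norm y" by (rule cauchy_schwarz)
    also have "\<dots> \<le> (norm f * norm x) * norm y"
      by (intro mult_right_mono norm_cblinfun_apply norm_ge_zero)
    finally show "cmod (cinner (f *\<^sub>V x) y) \<le> (norm f * norm y) * norm x"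
      by (simp add: mult_ac)
  qed (simp_all add: cblinfun_simps cinner_simps)
  then have "\<exists>g. \<forall>y x. cinner (f *\<^sub>V x) y = cinner x (g y)" by (intro choice allI)
  then obtain g where g: "\<And>x y. cinner (f *\<^sub>V x) y = cinner x (g y)" by blast
  have "\<exists>G. \<forall>y. G *\<^sub>V y = g y"
  proof (rule bounded_linear_imp_cblinfun)
    show "g (y + z) = g y + g z" for y z
      by (rule cinner_eqI_right) (simp add: cinner_simps g[symmetric])
    show "g (a *\<^sub>C y) = a *\<^sub>C g y" for a y
      by (rule cinner_eqI_right) (simp add: cinner_simps g[symmetric])
    fix y
    \<comment> \<open>The defining identity is tested at \<open>x = g y\<close>; one factor
      \<open>norm (g y)\<close> is then cancelled.\<close>
    have "(norm (g y))\<^sup>2 = cmod (cinner (f *\<^sub>V g y) y)"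
      by (simp add: g cinner_self norm_power)
    also have "\<dots> \<le> norm (f *\<^sub>V g y) * norm y" by (rule cauchy_schwarz)
    also have "\<dots> \<le> (norm f * norm (g y)) * norm y"
      by (intro mult_right_mono norm_cblinfun_apply norm_ge_zero)
    finally have "norm (g y) * norm (g y) \<le> norm (g y) * (norm f * norm y)"
      by (simp add: power2_eq_square mult_ac)
    then show "norm (g y) \<le> norm f * norm y"
      by (cases "g y = 0") simp_all
  qed
  then obtain G where G: "\<And>y. G *\<^sub>V y = g y" by blast
  have "\<exists>!g. \<forall>x y. cinner (f *\<^sub>V x) y = cinner x (g *\<^sub>V y)"
  proof (rule ex1I[of _ G])
    show "\<forall>x y. cinner (f *\<^sub>V x) y = cinner x (G *\<^sub>V y)" by (simp add: G g)
    show "G' = G" if "\<forall>x y. cinner (f *\<^sub>V x) y = cinner x (G' *\<^sub>V y)" for G'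
      by (rule cblinfun_eqI, rule cinner_eqI_right) (metis G g that)
  qed
  from theI'[OF this] show ?thesis unfolding adj_def by blast
qed

lemma cinner_adj_left: "cinner (adj f *\<^sub>V y) x = cinner y (f *\<^sub>V x)"
  using cinner_adj[of f x y] by (subst (1 2) cinner_commute) simp

lemma adj_eqI: "adj f = g" if "\<And>x y. cinner (f *\<^sub>V x) y = cinner x (g *\<^sub>V y)"
  by (rule cblinfun_eqI, rule cinner_eqI_right) (simp add: that cinner_adj[symmetric])

lemma adj_adj [simp]: "adj (adj f) = f"
  by (rule adj_eqI) (rule cinner_adj_left)

lemma adj_add: "adj (f + g) = adj f + adj g"
  by (rule adj_eqI) (simp add: cblinfun_simps cinner_simps cinner_adj)

lemma adj_scaleC: "adj (c *\<^sub>C f) = cnj c *\<^sub>C adj f"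
  by (rule adj_eqI) (simp add: cblinfun_simps cinner_simps cinner_adj)

lemma adj_compose: "adj (f o\<^sub>C\<^sub>L g) = adj g o\<^sub>C\<^sub>L adj f"
  by (rule adj_eqI) (simp add: cinner_adj)

lemma cblinfun_compose_assoc: "f o\<^sub>C\<^sub>L g o\<^sub>C\<^sub>L h = f o\<^sub>C\<^sub>L (g o\<^sub>C\<^sub>L h)"
  by (rule cblinfun_eqI) simp

lemma adj_triple: "adj (triple a b c) = triple (adj a) (adj b) (adj c)"
  unfolding triple_def
  by (simp add: adj_scaleC adj_add adj_compose cblinfun_compose_assoc add.commute)

section \<open>Operators of rank one\<close>

definition rank_one :: "'k::chilbert_space \<Rightarrow> 'h::chilbert_space \<Rightarrow> ('h \<Rightarrow>\<^sub>C\<^sub>L 'k)"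
  where "rank_one k h = (SOME F. \<forall>x. F *\<^sub>V x = cinner x h *\<^sub>C k)"

text \<open>Cauchy-Schwarz bounds the prescribed map, so the choice in \<open>rank_one\<close> is
  not void.\<close>

lemma rank_one_apply [simp]: "rank_one k h *\<^sub>V x = cinner x h *\<^sub>C k"
proof -
  have "\<exists>F. \<forall>x. F *\<^sub>V x = cinner x h *\<^sub>C k"
  proof (rule bounded_linear_imp_cblinfun)
    show "norm (cinner x h *\<^sub>C k) \<le> (norm h * norm k) * norm x" for x
      using mult_right_mono[OF cauchy_schwarz[of x h] norm_ge_zero[of k]]
      by (simp add: norm_scaleC mult_ac)
  qed (simp_all add: cinner_simps scaleC_add_left scaleC_scaleC)
  from someI_ex[OF this] show ?thesis unfolding rank_one_def by blast
qed

lemma adj_rank_one [simp]: "adj (rank_one k h) = rank_one h k"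
  by (rule adj_eqI)
    (simp add: cinner_simps cinner_commute[of k _, symmetric] mult.commute)

lemma rank_one_add_left: "rank_one (k + k') h = rank_one k h + rank_one k' h"
  by (rule cblinfun_eqI) (simp add: cblinfun_simps scaleC_add_right)

lemma rank_one_add_right: "rank_one k (h + h') = rank_one k h + rank_one k h'"
  by (rule cblinfun_eqI) (simp add: cblinfun_simps scaleC_add_left cinner_simps)

lemma rank_one_scaleC_left: "rank_one (c *\<^sub>C k) h = c *\<^sub>C rank_one k h"
  by (rule cblinfun_eqI) (simp add: cblinfun_simps scaleC_scaleC mult.commute)

lemma rank_one_scaleC_right: "rank_one k (c *\<^sub>C h) = cnj c *\<^sub>C rank_one k h"
  by (rule cblinfun_eqI) (simp add: cblinfun_simps scaleC_scaleC cinner_simps)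

lemma rank_one_zero_left [simp]: "rank_one 0 h = 0"
  by (rule cblinfun_eqI) simp

lemma rank_one_zero_right [simp]: "rank_one k 0 = 0"
  by (rule cblinfun_eqI) simp

lemma rank_one_eq_0: "rank_one k h = 0 \<longleftrightarrow> k = 0 \<or> h = 0"
proof
  assume "rank_one k h = 0"
  then have "cinner h h *\<^sub>C k = 0" by (metis rank_one_apply cblinfun_apply_zero)
  then show "k = 0 \<or> h = 0" by (auto simp: cinner_self_eq_0)
qed auto

lemma cblinfun_eq_by_cinner: "x = y" if "\<And>h k. cinner (x *\<^sub>V h) k = cinner (y *\<^sub>V h) k"
  by (rule cblinfun_eqI, rule cinner_eqI_left, rule that)


section \<open>Minimal tripotents and transition pseudo-probabilities\<close>

lemma cinner_self_unit: "norm x = 1 \<Longrightarrow> cinner x x = 1"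
  by (simp add: cinner_self)

lemma scaleC_half_eq_iff: "(1/2) *\<^sub>C x = y \<longleftrightarrow> x = 2 *\<^sub>C (y :: 'a::complex_vector)"
  by (auto simp: scaleC_scaleC scaleC_one)

lemma scaleC_two: "2 *\<^sub>C x = x + (x :: 'a::complex_vector)"
  using scaleC_add_left[of 1 1 x] by (simp add: scaleC_one)

lemma triple_apply:
  "triple x y z *\<^sub>V v
    = (1/2) *\<^sub>C (x *\<^sub>V adj y *\<^sub>V z *\<^sub>V v + z *\<^sub>V adj y *\<^sub>V x *\<^sub>V v)"
  by (simp add: triple_def cblinfun_simps)

lemma triple_same: "triple e e e *\<^sub>V v = e *\<^sub>V adj e *\<^sub>V e *\<^sub>V v"
  by (simp add: triple_apply scaleC_half_eq_iff scaleC_two)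

lemma triple_rank_one_apply:
  assumes "norm k = 1" "norm h = 1"
  shows "triple (rank_one k h) (rank_one k h) x *\<^sub>V v
    = (1/2) *\<^sub>C (cinner (x *\<^sub>V v) k *\<^sub>C k + cinner v h *\<^sub>C (x *\<^sub>V h))"
  using assms by (simp add: triple_apply cblinfun_simps cinner_simps cinner_self_unit)

text \<open>The coefficient is the conjugate of the value at \<open>x\<close> of the functional of
  \<open>k \<otimes> h\<close>, as the middle variable is conjugate-linear. A triple isomorphism
  therefore transports these functionals.\<close>

lemma rank_one_sandwich:
  "triple (rank_one k h) x (rank_one k h) = cnj (cinner (x *\<^sub>V h) k) *\<^sub>C rank_one k h"
proof (rule cblinfun_eqI)
  fix v
  have "cinner (adj x *\<^sub>V k) h = cnj (cinner (x *\<^sub>V h) k)"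
    by (simp add: cinner_adj_left cinner_commute[of k])
  then show "triple (rank_one k h) x (rank_one k h) *\<^sub>V v
      = (cnj (cinner (x *\<^sub>V h) k) *\<^sub>C rank_one k h) *\<^sub>V v"
    by (simp add: triple_apply cblinfun_simps cinner_simps scaleC_scaleC scaleC_half_eq_iff mult_ac
        flip: scaleC_add_left)
qed

text \<open>The eigenvalue equation, paired with \<open>k\<close> and evaluated at \<open>h\<close>,
  expresses every \<open>x v\<close> through the single number
  \<open>cinner (x h) k\<close>.\<close>

lemma peirce_space_2_rank_one:
  assumes "norm k = 1" "norm h = 1"
  shows "x \<in> peirce_space 2 (rank_one k h) \<longleftrightarrow> x = cinner (x *\<^sub>V h) k *\<^sub>C rank_one k h"
proof
  assume "x \<in> peirce_space 2 (rank_one k h)"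
  then have eq: "triple (rank_one k h) (rank_one k h) x *\<^sub>V v = x *\<^sub>V v" for v
    by (simp add: peirce_space_def scaleC_one)
  have e: "cinner (x *\<^sub>V v) k *\<^sub>C k + cinner v h *\<^sub>C (x *\<^sub>V h) = 2 *\<^sub>C (x *\<^sub>V v)" for v
    using eq[of v] by (simp add: triple_rank_one_apply assms scaleC_half_eq_iff)
  have e2: "cinner (x *\<^sub>V v) k = cinner v h * cinner (x *\<^sub>V h) k" for v
    using arg_cong[OF e[of v], of "\<lambda>y. cinner y k"] assms
    by (simp add: cinner_simps cinner_self_unit)
  have "2 *\<^sub>C (x *\<^sub>V h) = cinner (x *\<^sub>V h) k *\<^sub>C k + x *\<^sub>V h"
    using e[of h] assms by (simp add: cinner_self_unit scaleC_one)
  then have xh: "x *\<^sub>V h = cinner (x *\<^sub>V h) k *\<^sub>C k" by (simp add: scaleC_two)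
  have "2 *\<^sub>C (x *\<^sub>V v) = 2 *\<^sub>C (cinner v h *\<^sub>C cinner (x *\<^sub>V h) k *\<^sub>C k)" for v
  proof -
    have "2 *\<^sub>C (x *\<^sub>V v) = cinner (x *\<^sub>V v) k *\<^sub>C k + cinner v h *\<^sub>C cinner (x *\<^sub>V h) k *\<^sub>C k"
      using e[of v] by (subst (asm) xh) simp
    then show ?thesis
      by (subst (asm) e2) (simp add: scaleC_scaleC flip: scaleC_two)
  qed
  then have "x *\<^sub>V v = (cinner (x *\<^sub>V h) k *\<^sub>C rank_one k h) *\<^sub>V v" for v
    unfolding cblinfun_apply_scaleC rank_one_apply scaleC_scaleC mult.commute[of "cinner (x *\<^sub>V h) k"]
    by (metis complex_vector.scale_left_imp_eq scaleC_scaleC zero_neq_numeral)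
  then show "x = cinner (x *\<^sub>V h) k *\<^sub>C rank_one k h" by (rule cblinfun_eqI)
next
  assume x: "x = cinner (x *\<^sub>V h) k *\<^sub>C rank_one k h"
  have "triple (rank_one k h) (rank_one k h) (c *\<^sub>C rank_one k h) = c *\<^sub>C rank_one k h" for c
    by (rule cblinfun_eqI)
      (simp add: triple_rank_one_apply assms cblinfun_simps cinner_simps cinner_self_unit
        scaleC_half_eq_iff scaleC_scaleC scaleC_one mult_ac flip: scaleC_add_left)
  then show "x \<in> peirce_space 2 (rank_one k h)"
    by (subst x) (simp add: peirce_space_def scaleC_one)
qed

lemma rank_one_minimal_tripotent:
  assumes "norm k = 1" "norm h = 1"
  shows "rank_one k h \<in> minimal_tripotents"
proof -
  have "tripotent (rank_one k h)"
    unfolding tripotent_def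
    by (rule cblinfun_eqI)
      (simp add: triple_same cinner_simps cinner_self_unit assms scaleC_scaleC cblinfun_simps)
  moreover have "peirce_space 2 (rank_one k h) = range (\<lambda>c. c *\<^sub>C rank_one k h)"
  proof (intro set_eqI iffI)
    fix x assume "x \<in> range (\<lambda>c. c *\<^sub>C rank_one k h)"
    then obtain c where "x = c *\<^sub>C rank_one k h" by blast
    then show "x \<in> peirce_space 2 (rank_one k h)"
      by (simp add: peirce_space_2_rank_one assms cblinfun_simps cinner_simps cinner_self_unit)
  next
    fix x assume "x \<in> peirce_space 2 (rank_one k h)"
    then show "x \<in> range (\<lambda>c. c *\<^sub>C rank_one k h)"
      unfolding peirce_space_2_rank_one[OF assms] by (rule range_eqI)
  qed
  moreover have "rank_one k h \<noteq> 0" using assms by (auto simp: rank_one_eq_0)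
  then have "range (\<lambda>c. c *\<^sub>C rank_one k h) \<noteq> {0}"
    using rangeI[of "\<lambda>c. c *\<^sub>C rank_one k h" 1] by (auto simp: scaleC_one)
  ultimately show ?thesis by (simp add: minimal_tripotents_def)
qed

text \<open>A unit vector \<open>h\<close> in the initial space of \<open>e\<close> gives the piece
  \<open>k \<otimes> h\<close> of \<open>e\<close> with \<open>k = e h\<close>. This piece lies in
  the Peirce 2-space, hence is a multiple of \<open>e\<close> by minimality, and evaluation at
  \<open>h\<close> shows that the multiple is 1.\<close>

lemma minimal_tripotent_rank_one:
  assumes "e \<in> minimal_tripotents"
  obtains k h where "norm k = 1" "norm h = 1" "e = rank_one k h"
proof -
  have e: "e *\<^sub>V adj e *\<^sub>V e *\<^sub>V v = e *\<^sub>V v" for v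
    using assms triple_same[of e v] by (simp add: minimal_tripotents_def tripotent_def)
  have p2: "peirce_space 2 e = range (\<lambda>c. c *\<^sub>C e)" and "peirce_space 2 e \<noteq> {0}"
    using assms unfolding minimal_tripotents_def by blast+
  then have "e \<noteq> 0" by auto
  then obtain v where v: "e *\<^sub>V v \<noteq> 0" by (metis cblinfun_eqI cblinfun_apply_zero)
  \<comment> \<open>Applying \<open>adj e\<close> after \<open>e\<close> moves \<open>v\<close> into
    the initial space, where \<open>adj e\<close> inverts \<open>e\<close>.\<close>
  define w where "w = adj e *\<^sub>V e *\<^sub>V v"
  have "w \<noteq> 0" using v e[of v] by (auto simp: w_def)
  define h where "h = sgn w"
  have nh: "norm h = 1" using \<open>w \<noteq> 0\<close> by (simp add: h_def norm_sgn)
  have "adj e *\<^sub>V e *\<^sub>V w = w" by (simp add: w_def e)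
  then have ph: "adj e *\<^sub>V e *\<^sub>V h = h"
    by (simp add: h_def sgn_div_norm scaleR_eq_scaleC cblinfun_simps)
  define k where "k = e *\<^sub>V h"
  have "cinner k k = 1" by (simp add: k_def cinner_adj ph cinner_self_unit nh)
  then have "(norm k)\<^sup>2 = 1" using of_real_eq_1_iff unfolding cinner_self by blast
  then have nk: "norm k = 1" using norm_ge_zero[of k] by (simp add: power2_eq_1_iff del: norm_ge_zero)
  have "triple e e (rank_one k h) = rank_one k h"
  proof (rule cblinfun_eqI)
    fix u
    have "e *\<^sub>V adj e *\<^sub>V k = k" by (simp add: k_def e)
    moreover have "cinner (adj e *\<^sub>V e *\<^sub>V u) h = cinner u h"
      by (simp add: cinner_adj_left ph flip: cinner_adj) (simp add: cinner_adj ph)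
    ultimately show "triple e e (rank_one k h) *\<^sub>V u = rank_one k h *\<^sub>V u"
      by (simp add: triple_apply cblinfun_simps scaleC_half_eq_iff scaleC_scaleC flip: scaleC_add_left)
  qed
  then have "rank_one k h \<in> peirce_space 2 e" by (simp add: peirce_space_def scaleC_one)
  then obtain c where c: "rank_one k h = c *\<^sub>C e" using p2 by auto
  have "k = rank_one k h *\<^sub>V h" by (simp add: cinner_self_unit nh scaleC_one)
  also have "\<dots> = c *\<^sub>C k" unfolding c by (simp add: cblinfun_simps k_def)
  finally have "cinner k k = cinner (c *\<^sub>C k) k" by simp
  then have "c = 1" by (simp add: cinner_self_unit nk cinner_scaleC_left)
  with c have "e = rank_one k h" by (simp add: scaleC_one)
  with nk nh show thesis by (rule that)
qed

text \<open>The three Peirce components are written down explicitly, and uniqueness of the last one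
  is shown, as the definite description demands.\<close>

lemma peirce_proj2_rank_one:
  assumes "norm k = 1" "norm h = 1"
  shows "peirce_proj2 (rank_one k h) x = cinner (x *\<^sub>V h) k *\<^sub>C rank_one k h"
proof -
  let ?e = "rank_one k h"
  note s = triple_rank_one_apply[OF assms] cinner_self_unit[OF assms(1)] cinner_self_unit[OF assms(2)]
  define x2 where "x2 = cinner (x *\<^sub>V h) k *\<^sub>C ?e"
  \<comment> \<open>The operator \<open>triple e e\<close> has eigenvalues 0, 1/2, 1 on the
    components, so \<open>triple e e x\<close> must equal \<open>x2\<close> plus half of
    \<open>x1\<close>.\<close>
  define x1 where "x1 = 2 *\<^sub>C (triple ?e ?e x - x2)"
  define x0 where "x0 = x - x1 - x2"
  have x1v: "x1 *\<^sub>V v = cinner (x *\<^sub>V v) k *\<^sub>C k + cinner v h *\<^sub>C (x *\<^sub>V h)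
      - (2 * cinner (x *\<^sub>V h) k * cinner v h) *\<^sub>C k" for v
    by (simp add: x1_def x2_def cblinfun_simps s scaleC_scaleC scaleC_one scaleC_add_right
        complex_vector.scale_right_diff_distrib mult_ac)
  have "x2 \<in> peirce_space 2 ?e"
    by (simp add: peirce_space_2_rank_one assms x2_def cblinfun_simps s cinner_simps)
  moreover have "triple ?e ?e x1 = (1/2) *\<^sub>C x1"
    by (rule cblinfun_eqI)
      (simp add: s cblinfun_simps x1v cinner_simps scaleC_scaleC scaleC_one scaleC_add_right
        complex_vector.scale_right_diff_distrib complex_vector.scale_left_diff_distrib
        scaleC_add_left algebra_simps)
  then have "x1 \<in> peirce_space 1 ?e" by (simp add: peirce_space_def)
  moreover have "triple ?e ?e x0 = 0"
    by (rule cblinfun_eqI)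
      (simp add: s cblinfun_simps x0_def x2_def x1v cinner_simps scaleC_scaleC scaleC_one scaleC_add_right
        complex_vector.scale_right_diff_distrib complex_vector.scale_left_diff_distrib
        algebra_simps flip: scaleC_add_left)
  then have "x0 \<in> peirce_space 0 ?e"
    by (simp add: peirce_space_def complex_vector.scale_zero_left)
  moreover have "x = x0 + x1 + x2" by (simp add: x0_def)
  ultimately have ex: "x2 \<in> peirce_space 2 ?e \<and>
      (\<exists>x0 \<in> peirce_space 0 ?e. \<exists>x1 \<in> peirce_space 1 ?e. x = x0 + x1 + x2)" by blast
  have "y2 = x2" if y: "y2 \<in> peirce_space 2 ?e" "y0 \<in> peirce_space 0 ?e" "y1 \<in> peirce_space 1 ?e"
    "x = y0 + y1 + y2" for y0 y1 y2
  proof -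
    \<comment> \<open>The functional is invariant under \<open>triple e e\<close>, so it vanishes on
      the eigenspaces for 0 and 1/2 and sees only the Peirce 2-component.\<close>
    have t: "cinner (triple ?e ?e y *\<^sub>V h) k = cinner (y *\<^sub>V h) k" for y
      by (simp add: s cinner_simps scaleC_one)
    have "cinner (y0 *\<^sub>V h) k = 0"
      using y(2) t[of y0] by (simp add: peirce_space_def complex_vector.scale_zero_left)
    moreover have "cinner (y1 *\<^sub>V h) k = 0"
      using y(3) t[of y1] by (simp add: peirce_space_def cblinfun_simps cinner_simps)
    ultimately have "cinner (x *\<^sub>V h) k = cinner (y2 *\<^sub>V h) k"
      by (simp add: y(4) cblinfun_simps cinner_simps)
    then show ?thesis using y(1) by (simp add: peirce_space_2_rank_one assms x2_def)
  qed
  then have "peirce_proj2 ?e x = x2"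
    unfolding peirce_proj2_def by (intro the_equality ex) blast
  then show ?thesis by (simp add: x2_def)
qed

section \<open>The support functional of a minimal tripotent\<close>

lemma vanishes_of_quadratic_bound:
  fixes z :: complex
  assumes "\<And>t. (cmod (1 + t * z))\<^sup>2 \<le> 1 + C * (cmod t)\<^sup>2"
  shows "z = 0"
proof (rule ccontr)
  assume "z \<noteq> 0"
  define p where "p = (cmod z)\<^sup>2"
  have p: "p > 0" using \<open>z \<noteq> 0\<close> by (simp add: p_def)
  \<comment> \<open>The test value is \<open>t = s * cnj z\<close>, which makes \<open>t * z\<close>
    positive. The linear term then has order \<open>s\<close>, the allowed error order
    \<open>s\<close> squared, and \<open>C * s < 1\<close> makes them incompatible.\<close>
  define s where "s = 1 / (\<bar>C\<bar> + 1)"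
  have s: "s > 0" "C * s < 1"
    by (auto simp: s_def divide_less_eq intro: add_pos_nonneg)
  have "(of_real s * cnj z) * z = of_real (s * p)"
    using complex_norm_square[of z] by (simp add: p_def mult_ac)
  then have "1 + (of_real s * cnj z) * z = of_real (1 + s * p)" by simp
  then have "cmod (1 + (of_real s * cnj z) * z) = \<bar>1 + s * p\<bar>" by (simp only: norm_of_real)
  moreover have "0 \<le> 1 + s * p" using s p by simp
  ultimately have "cmod (1 + (of_real s * cnj z) * z) = 1 + s * p" by simp
  then have "(1 + s * p)\<^sup>2 \<le> 1 + C * (s\<^sup>2 * p)"
    using assms[of "of_real s * cnj z"] by (simp add: norm_mult power_mult_distrib p_def)
  then have "(s * p) * 2 \<le> (s * p) * (C * s)"
    using zero_le_power2[of "s * p"] by (simp add: power2_eq_square algebra_simps)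
  then have "2 \<le> C * s" using s p by simp
  then show False using s by simp
qed

text \<open>If \<open>cinner (y h) k = 0\<close>, then perturbing \<open>k \<otimes> h\<close> by
  \<open>t y\<close> changes the squared norm only to second order in \<open>t\<close>, which forces
  \<open>\<psi> y = 0\<close>. Every \<open>x\<close> is such a \<open>y\<close> plus a multiple of
  \<open>k \<otimes> h\<close>.\<close>

lemma norm_attaining_functional:
  fixes \<psi> :: "('h::chilbert_space \<Rightarrow>\<^sub>C\<^sub>L 'k::chilbert_space) \<Rightarrow>\<^sub>C\<^sub>L complex"
  assumes nk: "norm k = 1" and nh: "norm h = 1"
    and \<psi>: "norm \<psi> \<le> 1" "\<psi> *\<^sub>V rank_one k h = 1"
  shows "\<psi> *\<^sub>V x = cinner (x *\<^sub>V h) k"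
proof -
  have zero: "\<psi> *\<^sub>V y = 0" if y: "cinner (y *\<^sub>V h) k = 0" for y
  proof (rule vanishes_of_quadratic_bound[where C = "2 * (norm y)\<^sup>2"])
    fix t :: complex
    let ?b = "1 + 2 * (norm y)\<^sup>2 * (cmod t)\<^sup>2"
    \<comment> \<open>With \<open>v = \<alpha> h + w\<close>, the cross term sees only
      \<open>w\<close>, because \<open>y h\<close> is orthogonal to \<open>k\<close>. The inequality
      between arithmetic and geometric means then bounds it by the square of \<open>norm w\<close>,
      which is part of that of \<open>norm v\<close>, and a term of second order in
      \<open>t\<close>.\<close>
    have b: "(norm ((rank_one k h + t *\<^sub>C y) *\<^sub>V v))\<^sup>2 \<le> ?b * (norm v)\<^sup>2" for v
    proof -
      define \<alpha> where "\<alpha> = cinner v h"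
      define w where "w = v - \<alpha> *\<^sub>C h"
      have nv: "(norm v)\<^sup>2 = (cmod \<alpha>)\<^sup>2 + (norm w)\<^sup>2"
        using pythagoras_component[OF nh, of v] by (simp add: \<alpha>_def w_def)
      have yw: "cinner (y *\<^sub>V v) k = cinner (y *\<^sub>V w) k"
        by (simp add: w_def cblinfun_simps cinner_simps y)
      have yv: "norm (y *\<^sub>V v) \<le> norm y * norm v" by (rule norm_cblinfun_apply)
      have "cmod (cinner (y *\<^sub>V w) k) \<le> norm y * norm w"
        using cauchy_schwarz[of "y *\<^sub>V w" k] norm_cblinfun_apply[of y w] nk by simp
      then have "cmod \<alpha> * cmod t * cmod (cinner (y *\<^sub>V v) k) \<le> cmod \<alpha> * cmod t * (norm y * norm w)"
        by (simp add: yw mult_left_mono)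
      then have "cmod (cinner (\<alpha> *\<^sub>C k) (t *\<^sub>C (y *\<^sub>V v))) \<le> cmod \<alpha> * cmod t * (norm y * norm w)"
        by (simp add: cinner_simps norm_mult cinner_commute[of k] mult_ac)
      also have "2 * \<dots> \<le> (norm w)\<^sup>2 + (cmod \<alpha> * cmod t * norm y)\<^sup>2"
        using zero_le_power2[of "norm w - cmod \<alpha> * cmod t * norm y"]
        by (simp add: power2_eq_square algebra_simps)
      finally have "2 * Re (cinner (\<alpha> *\<^sub>C k) (t *\<^sub>C (y *\<^sub>V v)))
          \<le> (norm w)\<^sup>2 + (cmod \<alpha> * cmod t * norm y)\<^sup>2"
        using complex_Re_le_cmod[of "cinner (\<alpha> *\<^sub>C k) (t *\<^sub>C (y *\<^sub>V v))"] by linarith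
      moreover have "(cmod \<alpha> * cmod t * norm y)\<^sup>2 \<le> (norm y)\<^sup>2 * (cmod t)\<^sup>2 * (norm v)\<^sup>2"
        using mult_left_mono[of "(cmod \<alpha>)\<^sup>2" "(norm v)\<^sup>2" "(norm y)\<^sup>2 * (cmod t)\<^sup>2"]
        by (simp add: nv power_mult_distrib mult_ac)
      moreover have "(cmod t * norm (y *\<^sub>V v))\<^sup>2 \<le> (norm y)\<^sup>2 * (cmod t)\<^sup>2 * (norm v)\<^sup>2"
        using power_mono[OF mult_left_mono[OF yv norm_ge_zero[of t]], of 2]
        by (simp add: power_mult_distrib mult_ac)
      moreover have "(norm ((rank_one k h + t *\<^sub>C y) *\<^sub>V v))\<^sup>2
          = (cmod \<alpha>)\<^sup>2 + (cmod t * norm (y *\<^sub>V v))\<^sup>2 + 2 * Re (cinner (\<alpha> *\<^sub>C k) (t *\<^sub>C (y *\<^sub>V v)))"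
        by (simp add: cblinfun_simps norm_sq_add norm_scaleC nk \<alpha>_def)
      moreover have "?b * (norm v)\<^sup>2 = (norm v)\<^sup>2 + 2 * ((norm y)\<^sup>2 * (cmod t)\<^sup>2 * (norm v)\<^sup>2)"
        by (simp add: algebra_simps)
      ultimately show ?thesis using nv by linarith
    qed
    have "norm (rank_one k h + t *\<^sub>C y) \<le> sqrt ?b"
    proof (rule norm_cblinfun_bound)
      show "norm ((rank_one k h + t *\<^sub>C y) *\<^sub>V v) \<le> sqrt ?b * norm v" for v
        using real_le_rsqrt[OF b[of v]] by (simp add: real_sqrt_mult)
    qed simp
    moreover have "cmod (\<psi> *\<^sub>V (rank_one k h + t *\<^sub>C y)) \<le> 1 * norm (rank_one k h + t *\<^sub>C y)"
      using norm_cblinfun_apply mult_right_mono[OF \<psi>(1) norm_ge_zero] order_trans by blast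
    moreover have "\<psi> *\<^sub>V (rank_one k h + t *\<^sub>C y) = 1 + t * (\<psi> *\<^sub>V y)"
      by (simp add: cblinfun_simps \<psi>(2) scaleC_complex_def)
    ultimately have "cmod (1 + t * (\<psi> *\<^sub>V y)) \<le> sqrt ?b" by simp
    then show "(cmod (1 + t * (\<psi> *\<^sub>V y)))\<^sup>2 \<le> 1 + 2 * (norm y)\<^sup>2 * (cmod t)\<^sup>2"
      using power_mono[of "cmod (1 + t * (\<psi> *\<^sub>V y))" "sqrt ?b" 2] by simp
  qed
  have "\<psi> *\<^sub>V (x - cinner (x *\<^sub>V h) k *\<^sub>C rank_one k h) = 0"
    by (rule zero) (simp add: cblinfun_simps cinner_simps cinner_self_unit nk nh)
  then show ?thesis by (simp add: cblinfun_simps \<psi>(2) scaleC_complex_def)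
qed

text \<open>The vector functional given by \<open>h\<close> and \<open>k\<close> is extreme because
  both ends of a segment through it would have to take the value 1 at \<open>k \<otimes> h\<close>,
  which determines them. It is the only candidate because the Peirce projection prescribes its
  values.\<close>

lemma support_functional_rank_one:
  assumes nk: "norm k = 1" and nh: "norm h = 1"
  shows "support_functional (rank_one k h) *\<^sub>V x = cinner (x *\<^sub>V h) k"
proof -
  let ?e = "rank_one k h"
  let ?B = "{\<psi> \<in> predual. norm \<psi> \<le> 1}"
  have bound: "cmod (cinner (x *\<^sub>V h) k) \<le> 1 * norm x" for x
    using cauchy_schwarz[of "x *\<^sub>V h" k] norm_cblinfun_apply[of x h] nk nh by simp
  have "\<exists>\<phi>. \<forall>x. \<phi> *\<^sub>V x = cinner (x *\<^sub>V h) k"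
    by (rule bounded_linear_imp_cblinfun[OF _ _ bound])
      (simp_all add: cblinfun_simps cinner_simps scaleC_complex_def)
  then obtain \<phi> where \<phi>: "\<And>x. \<phi> *\<^sub>V x = cinner (x *\<^sub>V h) k" by blast
  have n: "norm \<phi> \<le> 1"
    by (rule norm_cblinfun_bound) (use bound in \<open>simp_all add: \<phi>\<close>)
  have "\<phi> \<in> predual"
    unfolding predual_def
  proof (intro CollectI exI conjI allI)
    \<comment> \<open>A vector functional is a trace-class functional with a single nonzero
      term.\<close>
    let ?\<xi> = "\<lambda>n::nat. if n = 0 then h else 0" and ?\<eta> = "\<lambda>n::nat. if n = 0 then k else 0"
    show "summable (\<lambda>n. (norm (?\<xi> n))\<^sup>2)" "summable (\<lambda>n. (norm (?\<eta> n))\<^sup>2)"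
      by (auto intro!: summable_finite[of "{0}"] split: if_splits)
    show "\<phi> *\<^sub>V x = (\<Sum>n. cinner (x *\<^sub>V ?\<xi> n) (?\<eta> n))" for x
      by (subst suminf_finite[of "{0}"]) (auto simp: \<phi> split: if_splits)
  qed
  with n have in_ball: "\<phi> \<in> ?B" by simp
  have eq: "a = \<phi>" if "norm a \<le> 1" "a *\<^sub>V ?e = 1" for a
    by (rule cblinfun_eqI) (simp add: \<phi> norm_attaining_functional[OF nk nh that])
  have "\<phi> extreme_point_of ?B"
    unfolding extreme_point_of_def
  proof (intro conjI in_ball ballI notI)
    fix a b assume a: "a \<in> ?B" and b: "b \<in> ?B" and "\<phi> \<in> open_segment a b"
    then obtain u where u: "0 < u" "u < 1" and ab: "a \<noteq> b" "\<phi> = (1 - u) *\<^sub>R a + u *\<^sub>R b"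
      by (auto simp: in_segment)
    have le: "cmod (c *\<^sub>V ?e) \<le> 1" if "c \<in> ?B" for c
    proof -
      have "norm ?e \<le> 1"
        by (rule norm_cblinfun_bound)
          (use cauchy_schwarz[of _ h] in \<open>auto simp: norm_scaleC nk nh\<close>)
      then have "norm c * norm ?e \<le> 1" using that by (simp add: mult_le_one)
      then show ?thesis using norm_cblinfun_apply[of c ?e] by linarith
    qed
    have one: "(1 - u) * Re (a *\<^sub>V ?e) + u * Re (b *\<^sub>V ?e) = 1"
    proof -
      have "\<phi> *\<^sub>V ?e = 1" by (simp add: \<phi> cinner_simps cinner_self_unit nk nh)
      then have "(1 - u) *\<^sub>R (a *\<^sub>V ?e) + u *\<^sub>R (b *\<^sub>V ?e) = 1" by (simp add: ab(2) cblinfun_simps)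
      from arg_cong[OF this, of Re] show ?thesis by simp
    qed
    \<comment> \<open>In the closed unit disc only the number 1 has real part at least 1; this
      upgrades the information on real parts to equality of values.\<close>
    have Re1: "c = 1" if "cmod c \<le> 1" "Re c \<ge> 1" for c
    proof -
      have "Re c = 1" using that complex_Re_le_cmod[of c] by linarith
      moreover have "(cmod c)\<^sup>2 \<le> 1" using that(1) by (simp add: power_le_one)
      ultimately have "Im c = 0" by (simp add: cmod_power2)
      with \<open>Re c = 1\<close> show ?thesis by (simp add: complex_eq_iff)
    qed
    have ra: "Re (a *\<^sub>V ?e) \<le> 1" and rb: "Re (b *\<^sub>V ?e) \<le> 1"
      using le[OF a] le[OF b] complex_Re_le_cmod order_trans by blast+
    have "(1 - u) * Re (a *\<^sub>V ?e) \<le> 1 - u" "u * Re (b *\<^sub>V ?e) \<le> u"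
      using mult_left_mono[OF ra, of "1 - u"] mult_left_mono[OF rb, of u] u by auto
    with one have "(1 - u) * Re (a *\<^sub>V ?e) \<ge> (1 - u) * 1" "u * Re (b *\<^sub>V ?e) \<ge> u * 1" by auto
    then have "Re (a *\<^sub>V ?e) \<ge> 1" "Re (b *\<^sub>V ?e) \<ge> 1" using u by (auto simp: mult_le_cancel_left)
    then have "a *\<^sub>V ?e = 1" "b *\<^sub>V ?e = 1" using Re1 le[OF a] le[OF b] by auto
    then show False using eq a b ab(1) by auto
  qed
  then have "support_functional ?e = \<phi>"
    unfolding support_functional_def
  proof (intro the_equality conjI allI)
    show "peirce_proj2 ?e x = (\<phi> *\<^sub>V x) *\<^sub>C ?e" for x
      by (simp add: peirce_proj2_rank_one nk nh \<phi>)
    fix \<psi> assume "\<psi> extreme_point_of ?B \<and> (\<forall>x. peirce_proj2 ?e x = (\<psi> *\<^sub>V x) *\<^sub>C ?e)"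
    then have "peirce_proj2 ?e x = (\<psi> *\<^sub>V x) *\<^sub>C ?e" for x by blast
    then have "(\<psi> *\<^sub>V x) *\<^sub>C ?e = (\<phi> *\<^sub>V x) *\<^sub>C ?e" for x
      by (simp only: peirce_proj2_rank_one nk nh \<phi>)
    moreover have "?e \<noteq> 0" using nk nh by (auto simp: rank_one_eq_0)
    ultimately have "\<psi> *\<^sub>V x = \<phi> *\<^sub>V x" for x by (metis complex_vector.scale_cancel_right)
    then show "\<psi> = \<phi>" by (rule cblinfun_eqI)
  qed
  then show ?thesis by (simp add: \<phi>)
qed

lemma TTP_rank_one:
  assumes "norm k = 1" "norm h = 1"
  shows "TTP v (rank_one k h) = cinner (v *\<^sub>V h) k"
  by (simp add: TTP_def support_functional_rank_one assms)


section \<open>Unitary and antiunitary maps\<close>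

text \<open>Linear and conjugate-linear maps are treated together: \<open>\<sigma>\<close> is the identity or conjugation.\<close>

locale semilinearity =
  fixes \<sigma> :: "complex \<Rightarrow> complex"
  assumes id_or_cnj: "\<sigma> = id \<or> \<sigma> = cnj"
begin

lemma \<sigma>_add: "\<sigma> (a + b) = \<sigma> a + \<sigma> b"
  and \<sigma>_mult: "\<sigma> (a * b) = \<sigma> a * \<sigma> b"
  and \<sigma>_cnj: "\<sigma> (cnj a) = cnj (\<sigma> a)"
  and \<sigma>_\<sigma> [simp]: "\<sigma> (\<sigma> a) = a"
  and \<sigma>_0 [simp]: "\<sigma> 0 = 0"
  and \<sigma>_1 [simp]: "\<sigma> 1 = 1"
  and \<sigma>_of_real [simp]: "\<sigma> (of_real r) = of_real r"
  using id_or_cnj by auto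

lemma \<sigma>_eq_iff [simp]: "\<sigma> a = \<sigma> b \<longleftrightarrow> a = b"
  using \<sigma>_\<sigma> by metis

lemma \<sigma>_eq_0 [simp]: "\<sigma> a = 0 \<longleftrightarrow> a = 0"
  using \<sigma>_eq_iff[of a 0] by simp

text \<open>For \<open>\<sigma> = cnj\<close> these are the antiunitary maps. Semilinearity and
  bijectivity are derived below from surjectivity and the inner product identity.\<close>

definition unitary :: "('a::chilbert_space \<Rightarrow> 'b::chilbert_space) \<Rightarrow> bool"
  where "unitary f \<longleftrightarrow> surj f \<and> (\<forall>x y. cinner (f x) (f y) = \<sigma> (cinner x y))"

lemma unitary_cinner: "unitary f \<Longrightarrow> cinner (f x) (f y) = \<sigma> (cinner x y)"
  by (simp add: unitary_def)

text \<open>As \<open>f\<close> is onto, its values separate vectors; additivity and semilinearity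
  of \<open>f\<close> are checked in this way.\<close>

lemma unitary_eqI:
  assumes "unitary f" "\<And>z. cinner x (f z) = cinner y (f z)"
  shows "x = y"
proof (rule cinner_eqI_left)
  show "cinner x w = cinner y w" for w
    using assms surjD[of f w] by (auto simp: unitary_def)
qed

lemma unitary_add: "f (x + y) = f x + f y" if "unitary f"
  by (rule unitary_eqI[OF that]) (simp add: cinner_add_left unitary_cinner that \<sigma>_add)

lemma unitary_scaleC: "f (c *\<^sub>C x) = \<sigma> c *\<^sub>C f x" if "unitary f"
  by (rule unitary_eqI[OF that]) (simp add: cinner_scaleC_left unitary_cinner that \<sigma>_mult)

lemma unitary_norm: "norm (f x) = norm x" if "unitary f"
proof -
  have "complex_of_real ((norm (f x))\<^sup>2) = \<sigma> (of_real ((norm x)\<^sup>2))"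
    using unitary_cinner[OF that, of x x] unfolding cinner_self .
  then have "(norm (f x))\<^sup>2 = (norm x)\<^sup>2" unfolding \<sigma>_of_real of_real_eq_iff .
  then show ?thesis by simp
qed

lemma unitary_bij: "bij f" if "unitary f"
proof (rule bijI)
  show "inj f"
  proof (rule injI)
    fix x y assume "f x = f y"
    then have "\<sigma> (cinner x z) = \<sigma> (cinner y z)" for z
      by (simp flip: unitary_cinner[OF that])
    then show "x = y" using cinner_eqI_left by auto
  qed
qed (use that in \<open>simp add: unitary_def\<close>)

lemma unitary_inv: "unitary (inv f)" if "unitary f"
  unfolding unitary_def
proof (intro conjI allI)
  show "surj (inv f)" using unitary_bij[OF that] by (simp add: bij_imp_bij_inv bij_is_surj)
  have "surj f" using that by (simp add: unitary_def)
  fix x y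
  have "\<sigma> (cinner (inv f x) (inv f y)) = cinner x y"
    using unitary_cinner[OF that, of "inv f x" "inv f y"] \<open>surj f\<close> by (simp add: surj_f_inv_f)
  then show "cinner (inv f x) (inv f y) = \<sigma> (cinner x y)" by (metis \<sigma>_\<sigma>)
qed

text \<open>\<open>S x\<close> is \<open>x\<close> preceded by the inverse of \<open>f\<close> and
  followed by \<open>g\<close>. It is complex-linear even when both maps are antiunitary, since the
  two conjugations cancel.\<close>

lemma unitary_conjugation:
  fixes f :: "'h1::chilbert_space \<Rightarrow> 'h2::chilbert_space"
    and g :: "'k1::chilbert_space \<Rightarrow> 'k2::chilbert_space"
  assumes f: "unitary f" and g: "unitary g"
  obtains S :: "('h1 \<Rightarrow>\<^sub>C\<^sub>L 'k1) \<Rightarrow> ('h2 \<Rightarrow>\<^sub>C\<^sub>L 'k2)"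
  where "\<And>x h. S x *\<^sub>V f h = g (x *\<^sub>V h)"
proof -
  note f' = unitary_inv[OF f]
  have inv: "inv f (f h) = h" for h
    using unitary_bij[OF f] by (simp add: bij_is_inj)
  have "\<exists>F. \<forall>v. F *\<^sub>V v = g (x *\<^sub>V inv f v)" for x :: "'h1 \<Rightarrow>\<^sub>C\<^sub>L 'k1"
  proof (rule bounded_linear_imp_cblinfun)
    show "norm (g (x *\<^sub>V inv f v)) \<le> norm x * norm v" for v
      using norm_cblinfun_apply[of x "inv f v"] by (simp add: unitary_norm[OF g] unitary_norm[OF f'])
  qed (simp_all add: unitary_add[OF f'] unitary_add[OF g] unitary_scaleC[OF f']
      unitary_scaleC[OF g] cblinfun_simps)
  then have "\<exists>S. \<forall>x v. S x *\<^sub>V v = g ((x :: 'h1 \<Rightarrow>\<^sub>C\<^sub>L 'k1) *\<^sub>V inv f v)"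
    by (intro choice allI)
  then obtain S :: "('h1 \<Rightarrow>\<^sub>C\<^sub>L 'k1) \<Rightarrow> ('h2 \<Rightarrow>\<^sub>C\<^sub>L 'k2)"
    where "\<And>x v. S x *\<^sub>V v = g (x *\<^sub>V inv f v)" by blast
  then show thesis by (intro that[of S]) (simp add: inv)
qed

lemma unitary_conjugation_properties:
  fixes S :: "('h1::chilbert_space \<Rightarrow>\<^sub>C\<^sub>L 'k1::chilbert_space) \<Rightarrow> ('h2::chilbert_space \<Rightarrow>\<^sub>C\<^sub>L 'k2::chilbert_space)"
  assumes f: "unitary f" and g: "unitary g" and S: "\<And>x h. S x *\<^sub>V f h = g (x *\<^sub>V h)"
  shows "S (x + y) = S x + S y" "S (c *\<^sub>C x) = \<sigma> c *\<^sub>C S x" "bij S"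
    "S (triple x y z) = triple (S x) (S y) (S z)" "S (rank_one k h) = rank_one (g k) (f h)"
proof -
  have eqI: "A = B" if "\<And>h. A *\<^sub>V f h = B *\<^sub>V f h" for A B :: "'h2 \<Rightarrow>\<^sub>C\<^sub>L 'k2"
  proof (rule cblinfun_eqI)
    show "A *\<^sub>V v = B *\<^sub>V v" for v
      using that f surjD[of f v] by (auto simp: unitary_def)
  qed
  show "S (x + y) = S x + S y"
    by (rule eqI) (simp add: S cblinfun_simps unitary_add[OF g])
  show "S (c *\<^sub>C x) = \<sigma> c *\<^sub>C S x"
    by (rule eqI) (simp add: S cblinfun_simps unitary_scaleC[OF g])
  show "S (rank_one k h) = rank_one (g k) (f h)"
    by (rule eqI) (simp add: S unitary_scaleC[OF g] unitary_cinner[OF f])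
  \<comment> \<open>The adjoint is conjugated by the same two maps in exchanged roles, so inner
    factors cancel in the triple product.\<close>
  have adj: "adj (S y) *\<^sub>V g k = f (adj y *\<^sub>V k)" for y k
  proof (rule unitary_eqI[OF f])
    fix h
    have "cinner (adj (S y) *\<^sub>V g k) (f h) = \<sigma> (cinner k (y *\<^sub>V h))"
      by (simp add: cinner_adj_left S unitary_cinner[OF g])
    also have "\<dots> = cinner (f (adj y *\<^sub>V k)) (f h)"
      by (simp add: unitary_cinner[OF f] cinner_adj_left)
    finally show "cinner (adj (S y) *\<^sub>V g k) (f h) = cinner (f (adj y *\<^sub>V k)) (f h)" .
  qed
  have "\<sigma> (1/2) = 1/2" using \<sigma>_of_real[of "1/2"] by simp
  then show "S (triple x y z) = triple (S x) (S y) (S z)"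
    by (intro eqI) (simp add: S triple_apply adj unitary_add[OF g] unitary_scaleC[OF g])
  show "bij S"
  proof (rule bijI)
    show "inj S"
    proof (intro injI cblinfun_eqI)
      fix x y h assume "S x = S y"
      then have "g (x *\<^sub>V h) = g (y *\<^sub>V h)" by (metis S)
      then show "x *\<^sub>V h = y *\<^sub>V h" using unitary_bij[OF g] by (metis bij_pointE)
    qed
    show "surj S"
      unfolding surj_def
    proof
      \<comment> \<open>The preimage of \<open>y\<close> is its conjugate by the inverse
        maps.\<close>
      fix y
      obtain S' :: "('h2 \<Rightarrow>\<^sub>C\<^sub>L 'k2) \<Rightarrow> ('h1 \<Rightarrow>\<^sub>C\<^sub>L 'k1)"
        where S': "\<And>x h. S' x *\<^sub>V inv f h = inv g (x *\<^sub>V h)"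
        using unitary_conjugation[OF unitary_inv[OF f] unitary_inv[OF g]] by blast
      have "surj g" using g by (simp add: unitary_def)
      have "S' y *\<^sub>V h = inv g (y *\<^sub>V f h)" for h
        using S'[of y "f h"] unitary_bij[OF f] by (simp add: bij_is_inj)
      then have "y = S (S' y)"
        by (intro eqI) (simp add: S surj_f_inv_f[OF \<open>surj g\<close>])
      then show "\<exists>x. y = S x" ..
    qed
  qed
qed

end


section \<open>Sesquilinear families of operators of rank one\<close>

text \<open>If \<open>b'\<close> is not a multiple of \<open>b\<close>, its part \<open>y\<close>
  orthogonal to \<open>b\<close> annihilates the first summand, so evaluation at \<open>y\<close>
  makes \<open>a'\<close> a multiple of \<open>a''\<close>. Evaluation at \<open>b\<close> then
  places \<open>a\<close> on the same line.\<close>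

lemma rank_one_sum_cases:
  assumes eq: "rank_one a b + rank_one a' b' = rank_one a'' b''" and "a \<noteq> 0" "b \<noteq> 0"
  shows "(\<exists>c. a' = c *\<^sub>C a) \<or> (\<exists>c. b' = c *\<^sub>C b)"
proof (rule disjCI)
  assume nb: "\<nexists>c. b' = c *\<^sub>C b"
  have ap: "cinner v b *\<^sub>C a + cinner v b' *\<^sub>C a' = cinner v b'' *\<^sub>C a''" for v
    using arg_cong[OF eq, of "\<lambda>x. x *\<^sub>V v"] by (simp add: cblinfun_simps)
  define r where "r = cinner b' b / cinner b b"
  define y where "y = b' - r *\<^sub>C b"
  have bb: "cinner b b \<noteq> 0" using \<open>b \<noteq> 0\<close> by (simp add: cinner_self_eq_0)
  have yb: "cinner y b = 0" using bb by (simp add: y_def r_def cinner_simps)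
  have b': "b' = y + r *\<^sub>C b" by (simp add: y_def)
  have "cinner y b' = cinner y y" unfolding b' by (simp add: cinner_simps yb)
  moreover have "y \<noteq> 0" using nb b' by auto
  ultimately have yb': "cinner y b' \<noteq> 0" by (simp add: cinner_self_eq_0)
  define s where "s = cinner y b'' / cinner y b'"
  have a': "a' = s *\<^sub>C a''"
  proof -
    have "cinner y b' *\<^sub>C a' = cinner y b'' *\<^sub>C a''" using ap[of y] by (simp add: yb)
    then have "inverse (cinner y b') *\<^sub>C cinner y b' *\<^sub>C a' = inverse (cinner y b') *\<^sub>C cinner y b'' *\<^sub>C a''"
      by simp
    then show ?thesis using yb' by (simp add: scaleC_scaleC scaleC_one s_def field_simps)
  qed
  show "\<exists>c. a' = c *\<^sub>C a"
  proof (cases "s = 0")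
    case True
    then show ?thesis using a' by (intro exI[of _ 0]) simp
  next
    case False
    have "cinner b b *\<^sub>C a = (cinner b b'' - cinner b b' * s) *\<^sub>C a''"
      using ap[of b] by (simp add: a' scaleC_scaleC complex_vector.scale_left_diff_distrib algebra_simps)
    moreover define t where "t = cinner b b'' - cinner b b' * s"
    ultimately have ta: "cinner b b *\<^sub>C a = t *\<^sub>C a''" by simp
    have "t \<noteq> 0" using ta bb \<open>a \<noteq> 0\<close> by auto
    have "(s / t * cinner b b) *\<^sub>C a = (s / t) *\<^sub>C t *\<^sub>C a''"
      by (simp only: ta scaleC_scaleC[symmetric, of "s / t" "cinner b b"])
    also have "\<dots> = a'" using \<open>t \<noteq> 0\<close> by (simp add: scaleC_scaleC a')
    finally show ?thesis by metis
  qed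
qed

text \<open>\<open>F k h\<close> stands for the image of \<open>k \<otimes> h\<close>, and
  \<open>pairing\<close> for the preservation of transition pseudo-probabilities after homogeneous
  extension. The choice \<open>\<sigma> = cnj\<close> is made for the family of adjoints.\<close>

locale rank_one_family = semilinearity \<sigma> for \<sigma> +
  fixes F :: "'k::chilbert_space \<Rightarrow> 'h::chilbert_space \<Rightarrow> ('h2::chilbert_space \<Rightarrow>\<^sub>C\<^sub>L 'k2::chilbert_space)"
  assumes rank: "\<exists>a b. F k h = rank_one a b"
    and onto: "\<exists>k h. F k h = rank_one a b"
    and pairing: "F k h = rank_one a b \<Longrightarrow> F k' h' = rank_one a' b' \<Longrightarrow>
      cinner a a' * cinner b' b = \<sigma> (cinner k k' * cinner h' h)"
begin

lemma cinner_F: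
  assumes "F k' h' = rank_one a' b'"
  shows "cinner (F k h *\<^sub>V b') a' = \<sigma> (cinner k k' * cinner h' h)"
proof -
  obtain a b where ab: "F k h = rank_one a b" using rank by blast
  from pairing[OF ab assms] show ?thesis by (simp add: ab cinner_scaleC_left mult.commute)
qed

text \<open>By \<open>onto\<close>, every pair \<open>a\<close>, \<open>b\<close> comes from a value
  of \<open>F\<close>, so operators are separated by pairing them with values of \<open>F\<close>.
  The sesquilinearity of \<open>F\<close> thus reduces to that of the pairing.\<close>

lemma eq_by_pairing:
  assumes "\<And>k' h' a b. (\<And>k h. cinner (F k h *\<^sub>V b) a = \<sigma> (cinner k k' * cinner h' h)) \<Longrightarrow>
    cinner (A *\<^sub>V b) a = cinner (B *\<^sub>V b) a"
  shows "A = B"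
proof (rule cblinfun_eq_by_cinner)
  fix b a
  obtain k' h' where "F k' h' = rank_one a b" using onto by blast
  from cinner_F[OF this] show "cinner (A *\<^sub>V b) a = cinner (B *\<^sub>V b) a" by (rule assms)
qed

lemma F_add_left: "F (k + k') h = F k h + F k' h"
  by (rule eq_by_pairing) (simp add: cblinfun_simps cinner_simps \<sigma>_add distrib_right)

lemma F_add_right: "F k (h + h') = F k h + F k h'"
  by (rule eq_by_pairing) (simp add: cblinfun_simps cinner_simps \<sigma>_add distrib_left)

lemma F_scaleC_left: "F (c *\<^sub>C k) h = \<sigma> c *\<^sub>C F k h"
  by (rule eq_by_pairing) (simp add: cblinfun_simps cinner_simps \<sigma>_mult mult_ac)

lemma F_scaleC_right: "F k (c *\<^sub>C h) = cnj (\<sigma> c) *\<^sub>C F k h"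
  by (rule eq_by_pairing) (simp add: cblinfun_simps cinner_simps \<sigma>_mult \<sigma>_cnj mult_ac)

lemma F_eq_0: "F k h = 0 \<longleftrightarrow> k = 0 \<or> h = 0"
proof
  assume "F k h = 0"
  then have "F k h = rank_one 0 0" by simp
  from pairing[OF this this] show "k = 0 \<or> h = 0" by (simp add: cinner_self_eq_0)
next
  show "k = 0 \<or> h = 0 \<Longrightarrow> F k h = 0"
    using F_scaleC_left[of 0 k h] F_scaleC_right[of k 0 h] by auto
qed

text \<open>Fixing one argument, the sum of the two values is again a value of \<open>F\<close>,
  hence of rank at most one.\<close>

lemma adjacent_left:
  assumes "F k h = rank_one a b" "a \<noteq> 0" "b \<noteq> 0" "F k h' = rank_one a' b'"
  shows "(\<exists>c. a' = c *\<^sub>C a) \<or> (\<exists>c. b' = c *\<^sub>C b)"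
proof -
  obtain a'' b'' where "F k (h + h') = rank_one a'' b''" using rank by blast
  then have "rank_one a b + rank_one a' b' = rank_one a'' b''" by (simp add: F_add_right assms)
  then show ?thesis using rank_one_sum_cases assms by blast
qed

lemma adjacent_right:
  assumes "F k h = rank_one a b" "a \<noteq> 0" "b \<noteq> 0" "F k' h = rank_one a' b'"
  shows "(\<exists>c. a' = c *\<^sub>C a) \<or> (\<exists>c. b' = c *\<^sub>C b)"
proof -
  obtain a'' b'' where "F (k + k') h = rank_one a'' b''" using rank by blast
  then have "rank_one a b + rank_one a' b' = rank_one a'' b''" by (simp add: F_add_left assms)
  then show ?thesis using rank_one_sum_cases assms by blast
qed

text \<open>This is the reverse direction: the sum is a value of \<open>F\<close> by
  \<open>onto\<close>, and pairing with all \<open>F u v\<close> pulls the equation back to the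
  operators \<open>k \<otimes> h\<close>.\<close>

lemma dependent_of_rank_one_sum:
  assumes "F k h + F k' h' = rank_one a b" "k \<noteq> 0" "h \<noteq> 0"
  shows "(\<exists>c. k' = c *\<^sub>C k) \<or> (\<exists>c. h' = c *\<^sub>C h)"
proof -
  obtain k'' h'' where "F k'' h'' = rank_one a b" using onto by blast
  then have eq: "F k h + F k' h' = F k'' h''" by (simp add: assms)
  have "rank_one k h + rank_one k' h' = rank_one k'' h''"
  proof (rule cblinfun_eq_by_cinner)
    fix v u
    obtain x y where xy: "F u v = rank_one x y" using rank by blast
    have "cinner ((F k h + F k' h') *\<^sub>V y) x = cinner (F k'' h'' *\<^sub>V y) x" by (simp add: eq)
    then show "cinner ((rank_one k h + rank_one k' h') *\<^sub>V v) u = cinner (rank_one k'' h'' *\<^sub>V v) u"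
      by (simp add: cblinfun_simps cinner_simps cinner_F[OF xy] mult.commute flip: \<sigma>_add)
  qed
  then show ?thesis using rank_one_sum_cases assms by blast
qed

lemma dependent_of_left:
  assumes "F k h = rank_one a b" "F k' h' = rank_one (c *\<^sub>C a) b'" "k \<noteq> 0" "h \<noteq> 0"
  shows "(\<exists>c. k' = c *\<^sub>C k) \<or> (\<exists>c. h' = c *\<^sub>C h)"
proof (rule dependent_of_rank_one_sum[OF _ assms(3,4)])
  show "F k h + F k' h' = rank_one a (b + cnj c *\<^sub>C b')"
    by (simp add: assms rank_one_add_right rank_one_scaleC_left rank_one_scaleC_right)
qed

lemma dependent_of_right:
  assumes "F k h = rank_one a b" "F k' h' = rank_one a' (c *\<^sub>C b)" "k \<noteq> 0" "h \<noteq> 0"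
  shows "(\<exists>c. k' = c *\<^sub>C k) \<or> (\<exists>c. h' = c *\<^sub>C h)"
proof (rule dependent_of_rank_one_sum[OF _ assms(3,4)])
  show "F k h + F k' h' = rank_one (a + cnj c *\<^sub>C a') b"
    by (simp add: assms rank_one_add_left rank_one_scaleC_left rank_one_scaleC_right)
qed

end


section \<open>Factorization of a family into two unitary or antiunitary maps\<close>

lemma scaleC_inverse_scaleC: "c \<noteq> 0 \<Longrightarrow> inverse c *\<^sub>C c *\<^sub>C x = (x :: 'a::complex_vector)"
  by (simp add: scaleC_scaleC scaleC_one)

lemma rank_one_left_eqD:
  assumes "rank_one a b = rank_one a b'" "a \<noteq> 0"
  shows "b = b'"
proof -
  have "rank_one a (b - b') = 0"
    using assms(1) rank_one_add_right[of a "b - b'" b'] by simp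
  then show ?thesis using assms(2) by (simp add: rank_one_eq_0)
qed

lemma rank_one_right_eqD:
  assumes "rank_one a b = rank_one a' b" "b \<noteq> 0"
  shows "a = a'"
proof -
  have "rank_one (a - a') b = 0"
    using assms(1) rank_one_add_left[of "a - a'" a' b] by simp
  then show ?thesis using assms(2) by (simp add: rank_one_eq_0)
qed

lemma orthogonal_not_multiple:
  assumes "cinner x y = 0" "x \<noteq> 0" "y \<noteq> 0"
  shows "y \<noteq> c *\<^sub>C x"
proof
  assume y: "y = c *\<^sub>C x"
  then have "cinner x x = 0" using assms by (auto simp: cinner_simps complex_vector.scale_zero_left)
  then show False using assms by (simp add: cinner_self_eq_0)
qed

lemma eq_0_of_orthogonal_multiples:
  assumes "y = c *\<^sub>C b" "y = d *\<^sub>C b'" "cinner b b' = 0"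
  shows "y = 0"
proof -
  have "cinner y y = cinner (c *\<^sub>C b) (d *\<^sub>C b')" using assms(1,2) by simp
  also have "\<dots> = 0" by (simp add: cinner_simps assms(3))
  finally show ?thesis by (simp add: cinner_self_eq_0)
qed

context rank_one_family
begin

text \<open>The common factor \<open>a0\<close> in \<open>F00\<close> and \<open>F01\<close> selects
  the case in which the second argument governs the second factor. The row at \<open>k0\<close>
  defines \<open>f\<close>, the column at \<open>h0\<close> defines \<open>g\<close>, and a rank
  argument determines all other values.\<close>

lemma factorization:
  assumes unit: "norm k0 = 1" "norm h0 = 1" "norm k1 = 1" "norm h1 = 1"
    and orth: "cinner k0 k1 = 0" "cinner h0 h1 = 0"
    and a0: "norm a0 = 1"
    and F00: "F k0 h0 = rank_one a0 b0" and F01: "F k0 h1 = rank_one a0 b1"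
  shows "\<exists>g f. unitary g \<and> unitary f \<and> (\<forall>k h. F k h = rank_one (g k) (f h))"
proof -
  have nz: "k0 \<noteq> 0" "h0 \<noteq> 0" "k1 \<noteq> 0" "h1 \<noteq> 0" "a0 \<noteq> 0" using unit a0 by auto
  have aa: "cinner a0 a0 = 1" using a0 by (simp add: cinner_self_unit)
  have orth': "cinner k1 k0 = 0" "cinner h1 h0 = 0"
    using orth cinner_commute[of k1 k0] cinner_commute[of h1 h0] by simp_all
  have bb: "cinner b0 b0 = 1"
    using pairing[OF F00 F00] unit by (simp add: aa cinner_self_unit)
  then have b0: "b0 \<noteq> 0" by auto
  have b01: "cinner b0 b1 = 0" using pairing[OF F01 F00] by (simp add: aa orth)
  have b1: "b1 \<noteq> 0" using F01 F_eq_0[of k0 h1] nz by auto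
  have k01: "k1 \<noteq> c *\<^sub>C k0" and h01: "h1 \<noteq> c *\<^sub>C h0" and h10: "h0 \<noteq> c *\<^sub>C h1" for c
    using orthogonal_not_multiple orth orth' nz by blast+
  \<comment> \<open>A value without range vector along \<open>a0\<close> would have its second
    factor on the two orthogonal lines of \<open>b0\<close> and \<open>b1\<close>, hence be
    0.\<close>
  have left: "\<exists>b. F k0 h = rank_one a0 b" for h
  proof -
    obtain x y where xy: "F k0 h = rank_one x y" using rank by blast
    from adjacent_left[OF F00 nz(5) b0 xy] adjacent_left[OF F01 nz(5) b1 xy]
    consider c where "x = c *\<^sub>C a0" | c d where "y = c *\<^sub>C b0" "y = d *\<^sub>C b1" by blast
    then show ?thesis
    proof cases
      case 1
      then show ?thesis
        by (intro exI[of _ "cnj c *\<^sub>C y"]) (simp add: xy rank_one_scaleC_left rank_one_scaleC_right)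
    next
      case 2
      then have "y = 0" using eq_0_of_orthogonal_multiples b01 by blast
      then show ?thesis using xy by (intro exI[of _ 0]) simp
    qed
  qed
  \<comment> \<open>A range vector along \<open>a0\<close> would make \<open>F k1 h0\<close>
    adjacent to \<open>F k0 h1\<close>, although neither pair of arguments is dependent. So
    \<open>F k1 h0\<close> shares \<open>b0\<close> with \<open>F k0 h0\<close>.\<close>
  obtain a1 where F10: "F k1 h0 = rank_one a1 b0"
  proof -
    obtain x y where xy: "F k1 h0 = rank_one x y" using rank by blast
    have "x \<noteq> c *\<^sub>C a0" for c
    proof
      assume "x = c *\<^sub>C a0"
      then have "F k1 h0 = rank_one (c *\<^sub>C a0) y" using xy by simp
      from dependent_of_left[OF F01 this nz(1,4)] show False using k01 h10 by blast
    qed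
    with adjacent_right[OF F00 nz(5) b0 xy] obtain c where "y = c *\<^sub>C b0" by blast
    then show ?thesis
      by (intro that[of "cnj c *\<^sub>C x"]) (simp add: xy rank_one_scaleC_left rank_one_scaleC_right)
  qed
  have a1: "a1 \<noteq> 0" using F10 F_eq_0[of k1 h0] nz by auto
  have a01: "cinner a0 a1 = 0" using pairing[OF F00 F10] by (simp add: bb orth)
  have right: "\<exists>a. F k h0 = rank_one a b0" for k
  proof -
    obtain x y where xy: "F k h0 = rank_one x y" using rank by blast
    from adjacent_right[OF F00 nz(5) b0 xy] adjacent_right[OF F10 a1 b0 xy]
    consider c where "y = c *\<^sub>C b0" | c d where "x = c *\<^sub>C a0" "x = d *\<^sub>C a1" by blast
    then show ?thesis
    proof cases
      case 1
      then show ?thesis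
        by (intro exI[of _ "cnj c *\<^sub>C x"]) (simp add: xy rank_one_scaleC_left rank_one_scaleC_right)
    next
      case 2
      then have "x = 0" using eq_0_of_orthogonal_multiples a01 by blast
      then show ?thesis using xy by (intro exI[of _ 0]) simp
    qed
  qed
  from left have "\<exists>f. \<forall>h. F k0 h = rank_one a0 (f h)" by (intro choice allI)
  then obtain f where f: "\<And>h. F k0 h = rank_one a0 (f h)" by blast
  from right have "\<exists>g. \<forall>k. F k h0 = rank_one (g k) b0" by (intro choice allI)
  then obtain g where g: "\<And>k. F k h0 = rank_one (g k) b0" by blast
  have f0: "f h0 = b0" using f[of h0] F00 nz(5) by (metis rank_one_left_eqD)
  have g0: "g k0 = a0" using g[of k0] F00 b0 by (metis rank_one_right_eqD)
  have f_scale: "f (c *\<^sub>C h) = \<sigma> c *\<^sub>C f h" for c h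
  proof (rule rank_one_left_eqD[OF _ nz(5)])
    show "rank_one a0 (f (c *\<^sub>C h)) = rank_one a0 (\<sigma> c *\<^sub>C f h)"
      by (simp add: rank_one_scaleC_right F_scaleC_right flip: f)
  qed
  have g_scale: "g (c *\<^sub>C k) = \<sigma> c *\<^sub>C g k" for c k
  proof (rule rank_one_right_eqD[OF _ b0])
    show "rank_one (g (c *\<^sub>C k)) b0 = rank_one (\<sigma> c *\<^sub>C g k) b0"
      by (simp add: rank_one_scaleC_left F_scaleC_left flip: g)
  qed
  have f_cinner: "cinner (f h) (f h') = \<sigma> (cinner h h')" for h h'
    using pairing[OF f[of h'] f[of h]] unit by (simp add: aa cinner_self_unit)
  have g_cinner: "cinner (g k) (g k') = \<sigma> (cinner k k')" for k k'
    using pairing[OF g[of k] g[of k']] unit by (simp add: bb cinner_self_unit)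
  \<comment> \<open>Independence from \<open>k0\<close> and \<open>h0\<close> excludes a factor
    along \<open>a0\<close> or \<open>b0\<close>. Adjacency to the row and column entries therefore
    fixes both factors up to one scalar \<open>c\<close>.\<close>
  have F_generic: "F k h = rank_one (g k) (f h)"
    if k: "\<And>c. k \<noteq> c *\<^sub>C k0" and h: "\<And>c. h \<noteq> c *\<^sub>C h0" for k h
  proof -
    have "k \<noteq> 0" "h \<noteq> 0"
      using k[of 0] h[of 0] by (auto simp: complex_vector.scale_zero_left)
    have gk: "g k \<noteq> 0" using F_eq_0[of k h0] g[of k] \<open>k \<noteq> 0\<close> nz by auto
    have fh: "f h \<noteq> 0" using F_eq_0[of k0 h] f[of h] \<open>h \<noteq> 0\<close> nz by auto
    have gk_a0: "g k \<noteq> c *\<^sub>C a0" for c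
    proof
      assume "g k = c *\<^sub>C a0"
      then have "F k h0 = rank_one (c *\<^sub>C a0) b0" using g by simp
      from dependent_of_left[OF F01 this nz(1,4)] show False using k h10 by blast
    qed
    have fh_b0: "f h \<noteq> c *\<^sub>C b0" for c
    proof
      assume "f h = c *\<^sub>C b0"
      then have "F k0 h = rank_one a0 (c *\<^sub>C b0)" using f by simp
      moreover have "k0 \<noteq> c *\<^sub>C k1" for c using orthogonal_not_multiple orth' nz by blast
      ultimately show False using dependent_of_right[OF F10 _ nz(3,2)] h by blast
    qed
    obtain x y where xy: "F k h = rank_one x y" using rank by blast
    have "x \<noteq> c *\<^sub>C a0" for c
    proof
      assume "x = c *\<^sub>C a0"
      then have "F k h = rank_one (c *\<^sub>C a0) y" using xy by simp
      from dependent_of_left[OF F00 this nz(1,2)] show False using k h by blast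
    qed
    with adjacent_right[OF f nz(5) fh xy] obtain d where y: "y = d *\<^sub>C f h" by blast
    have "y \<noteq> c *\<^sub>C b0" for c
    proof
      assume "y = c *\<^sub>C b0"
      then have "F k h = rank_one x (c *\<^sub>C b0)" using xy by simp
      from dependent_of_right[OF F00 this nz(1,2)] show False using k h by blast
    qed
    with adjacent_left[OF g gk b0 xy] obtain d' where x: "x = d' *\<^sub>C g k" by blast
    define c where "c = cnj d' * d"
    have Fc: "F k h = rank_one (g k) (c *\<^sub>C f h)"
      by (simp add: xy x y c_def rank_one_scaleC_left rank_one_scaleC_right scaleC_scaleC)
    \<comment> \<open>The four values at \<open>k, k0\<close> and \<open>h, h0\<close> add up to an operator of rank one, which forces
      the matrix with entries \<open>c, 1, 1, 1\<close> to be singular.\<close>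
    obtain p q where "F (k + k0) (h + h0) = rank_one p q" using rank by blast
    then have "F k h + F k h0 + (F k0 h + F k0 h0) = rank_one p q"
      by (simp only: F_add_left F_add_right add_ac)
    then have "rank_one (g k) (c *\<^sub>C f h + b0) + rank_one a0 (f h + b0) = rank_one p q"
      by (simp only: Fc f[of h] g[of k] F00 rank_one_add_right)
    moreover have "c *\<^sub>C f h + b0 \<noteq> 0"
    proof
      assume *: "c *\<^sub>C f h + b0 = 0"
      then have "c \<noteq> 0" using b0 by auto
      have "c *\<^sub>C f h = (- 1) *\<^sub>C b0" using * by (simp add: scaleC_minus_one eq_neg_iff_add_eq_0)
      then have "f h = inverse c *\<^sub>C (- 1) *\<^sub>C b0" using scaleC_inverse_scaleC[OF \<open>c \<noteq> 0\<close>] by metis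
      then show False using fh_b0[of "inverse c * (- 1)"] by (simp add: scaleC_scaleC)
    qed
    moreover have "a0 \<noteq> r *\<^sub>C g k" for r
    proof
      assume r: "a0 = r *\<^sub>C g k"
      then have "r \<noteq> 0" using nz by auto
      then have "g k = inverse r *\<^sub>C a0" unfolding r by (rule scaleC_inverse_scaleC[symmetric])
      then show False using gk_a0 by blast
    qed
    ultimately obtain r where r: "f h + b0 = r *\<^sub>C (c *\<^sub>C f h + b0)"
      using rank_one_sum_cases gk by blast
    then have r': "(1 - r * c) *\<^sub>C f h = (r - 1) *\<^sub>C b0"
      by (simp add: complex_vector.scale_left_diff_distrib scaleC_add_right scaleC_scaleC scaleC_one
          algebra_simps)
    \<comment> \<open>Since \<open>f h\<close> is not a multiple of \<open>b0\<close>, both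
      coefficients in \<open>r'\<close> vanish.\<close>
    have "1 - r * c = 0"
    proof (rule ccontr)
      assume "1 - r * c \<noteq> 0"
      then have "f h = inverse (1 - r * c) *\<^sub>C (r - 1) *\<^sub>C b0"
        using r' scaleC_inverse_scaleC by metis
      then show False using fh_b0 by (simp add: scaleC_scaleC)
    qed
    moreover from this r' b0 have "r = 1" by simp
    ultimately have "c = 1" by simp
    then show ?thesis using Fc by (simp add: scaleC_one)
  qed
  have F: "F k h = rank_one (g k) (f h)" for k h
  proof -
    consider c where "k = c *\<^sub>C k0" | c where "h = c *\<^sub>C h0"
      | "\<And>c. k \<noteq> c *\<^sub>C k0" "\<And>c. h \<noteq> c *\<^sub>C h0" by blast
    then show ?thesis
    proof cases
      case 1
      then show ?thesis by (simp add: F_scaleC_left f g_scale g0 rank_one_scaleC_left)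
    next
      case 2
      then show ?thesis by (simp add: F_scaleC_right g f_scale f0 rank_one_scaleC_right)
    qed (rule F_generic)
  qed
  have "surj f" unfolding surj_def
  proof
    fix y
    obtain k h where "F k h = rank_one a0 y" using onto by blast
    then have eq: "rank_one a0 y = rank_one (g k) (f h)" by (simp add: F)
    \<comment> \<open>Taking the component of both sides along \<open>a0\<close> exhibits
      \<open>y\<close> as a multiple of \<open>f h\<close>; semilinearity moves the scalar into the
      argument.\<close>
    have "y = cnj (cinner (g k) a0) *\<^sub>C f h"
    proof (rule rank_one_left_eqD[OF cblinfun_eqI nz(5)])
      fix v
      have "cinner v y *\<^sub>C a0 = cinner v (f h) *\<^sub>C g k"
        using arg_cong[OF eq, of "\<lambda>x. x *\<^sub>V v"] by simp
      from arg_cong[OF this, of "\<lambda>x. cinner x a0"]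
      show "rank_one a0 y *\<^sub>V v = rank_one a0 (cnj (cinner (g k) a0) *\<^sub>C f h) *\<^sub>V v"
        by (simp add: cinner_simps aa mult.commute)
    qed
    also have "\<dots> = f (\<sigma> (cnj (cinner (g k) a0)) *\<^sub>C h)" by (simp add: f_scale)
    finally show "\<exists>h. y = f h" ..
  qed
  moreover have "surj g" unfolding surj_def
  proof
    fix x
    obtain k h where "F k h = rank_one x b0" using onto by blast
    then have eq: "rank_one x b0 = rank_one (g k) (f h)" by (simp add: F)
    have "x = cinner b0 (f h) *\<^sub>C g k"
      using arg_cong[OF eq, of "\<lambda>x. x *\<^sub>V b0"] by (simp add: bb scaleC_one)
    also have "\<dots> = g (\<sigma> (cinner b0 (f h)) *\<^sub>C k)" by (simp add: g_scale)
    finally show "\<exists>k. x = g k" ..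
  qed
  ultimately show ?thesis
    using f_cinner g_cinner F unfolding unitary_def by blast
qed

end

text \<open>Adjoints exchange the two factors, so this reduces the case of a common corange to the
  one treated in \<open>factorization\<close>, at the price of a conjugation.\<close>

lemma rank_one_family_adj:
  assumes "rank_one_family id F"
  shows "rank_one_family cnj (\<lambda>k h. adj (F k h))"
proof -
  interpret rank_one_family id F by (rule assms)
  have adj_iff: "adj X = rank_one b a \<longleftrightarrow> X = rank_one a b" for X and a b
    by (metis adj_adj adj_rank_one)
  show ?thesis
  proof
    fix k h k' h' a b a' b'
    show "\<exists>b a. adj (F k h) = rank_one b a" using rank adj_iff by blast
    show "\<exists>k h. adj (F k h) = rank_one b a" using onto adj_iff by blast
    assume "adj (F k h) = rank_one b a" "adj (F k' h') = rank_one b' a'"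
    then have "cinner a a' * cinner b' b = cinner k k' * cinner h' h"
      using pairing by (simp add: adj_iff)
    then show "cinner b b' * cinner a' a = cnj (cinner k k' * cinner h' h)"
      by (metis cinner_commute complex_cnj_mult mult.commute)
  qed simp
qed

section \<open>Orthonormal pairs, normalization and transported functionals\<close>

lemma orthonormal_pair:
  assumes "cdim_at_least 2 TYPE('a::chilbert_space)"
  obtains x y :: "'a::chilbert_space" where "norm x = 1" "norm y = 1" "cinner x y = 0"
proof -
  obtain B :: "'a::chilbert_space set" where B: "card B = 2" "complex_vector.independent B"
    using assms unfolding cdim_at_least_def by blast
  then obtain u v where uv: "B = {u, v}" "u \<noteq> v" by (auto simp: card_2_iff)
  have ind: "u \<notin> complex_vector.span {v}" "v \<noteq> 0"
    using B(2) uv by (auto simp: complex_vector.independent_insert complex_vector.dependent_zero)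
  define x where "x = sgn v"
  define w where "w = u - cinner u x *\<^sub>C x"
  have nx: "norm x = 1" using ind by (simp add: x_def norm_sgn)
  have "x \<in> complex_vector.span {v}"
    by (simp add: x_def sgn_div_norm scaleR_eq_scaleC complex_vector.span_scale complex_vector.span_base)
  then have "cinner u x *\<^sub>C x \<in> complex_vector.span {v}" by (rule complex_vector.span_scale)
  then have "w \<noteq> 0" using ind(1) by (auto simp: w_def)
  have wx: "cinner w x = 0" by (simp add: w_def cinner_simps cinner_self_unit nx)
  show thesis
  proof
    show "norm (sgn w) = 1" using \<open>w \<noteq> 0\<close> by (simp add: norm_sgn)
    show "cinner (sgn w) x = 0" by (simp add: cinner_sgn wx)
  qed (rule nx)
qed

lemma cinner_sgn_right: "cinner x (sgn y) = cinner x y / norm y"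
  by (simp add: sgn_div_norm scaleR_eq_scaleC cinner_scaleC_right divide_inverse mult.commute)

lemma sgn_unit: "norm x = 1 \<Longrightarrow> sgn x = (x :: 'a::real_normed_vector)"
  by (simp add: sgn_div_norm)

lemma cnormalize: "complex_of_real (norm x) *\<^sub>C sgn x = (x :: 'a::complex_inner)"
  by (cases "x = 0") (simp_all add: sgn_div_norm flip: scaleR_eq_scaleC)

lemma rank_one_normalize:
  "rank_one a b = complex_of_real (norm a * norm b) *\<^sub>C rank_one (sgn a) (sgn b)"
proof -
  have "rank_one a b = rank_one (complex_of_real (norm a) *\<^sub>C sgn a) (complex_of_real (norm b) *\<^sub>C sgn b)"
    by (simp only: cnormalize)
  then show ?thesis by (simp add: rank_one_scaleC_left rank_one_scaleC_right scaleC_scaleC)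
qed

lemma triple_isomorphism_functional:
  assumes T: "triple_isomorphism T" and "norm k = 1" "norm h = 1" "norm k' = 1" "norm h' = 1"
    and e: "T (rank_one k h) = rank_one k' h'"
  shows "cinner (T x *\<^sub>V h') k' = cinner (x *\<^sub>V h) k"
proof -
  interpret Vector_Spaces.linear scaleC scaleC T using T by (simp add: triple_isomorphism_def)
  have "T (triple (rank_one k h) x (rank_one k h)) = triple (rank_one k' h') (T x) (rank_one k' h')"
    using T by (simp add: triple_isomorphism_def e)
  then have "cnj (cinner (x *\<^sub>V h) k) *\<^sub>C rank_one k' h' = cnj (cinner (T x *\<^sub>V h') k') *\<^sub>C rank_one k' h'"
    by (simp add: rank_one_sandwich scale e)
  moreover have "rank_one k' h' \<noteq> 0" using assms by (auto simp: rank_one_eq_0)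
  ultimately show ?thesis by simp
qed

section \<open>Existence and uniqueness of the triple isomorphism\<close>

theorem theorem4p4:
  fixes \<Phi> :: "('h1::chilbert_space \<Rightarrow>\<^sub>C\<^sub>L 'k1::chilbert_space) \<Rightarrow>
               ('h2::chilbert_space \<Rightarrow>\<^sub>C\<^sub>L 'k2::chilbert_space)"
  assumes "cdim_at_least 2 TYPE('h1)" and "cdim_at_least 2 TYPE('k1)"
    and "cdim_at_least 2 TYPE('h2)" and "cdim_at_least 2 TYPE('k2)"
    and "bij_betw \<Phi> minimal_tripotents minimal_tripotents"
    and "\<forall>e \<in> minimal_tripotents. \<forall>v \<in> minimal_tripotents. TTP (\<Phi> v) (\<Phi> e) = TTP v e"
  shows "\<exists>!T. triple_isomorphism T \<and> (\<forall>e \<in> minimal_tripotents. T e = \<Phi> e)"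
proof -
  have image: "\<Phi> ` minimal_tripotents = minimal_tripotents"
    using assms(5) by (simp add: bij_betw_def)
  \<comment> \<open>The positively homogeneous extension of \<open>\<Phi>\<close>. If an argument is
    0, then \<open>\<Phi>\<close> is evaluated outside its domain, but the scalar factor makes the
    product 0.\<close>
  define F where "F k h = complex_of_real (norm k * norm h) *\<^sub>C \<Phi> (rank_one (sgn k) (sgn h))" for k h
  have F_unit: "F k h = \<Phi> (rank_one k h)" if "norm k = 1" "norm h = 1" for k h
    using that by (simp add: F_def sgn_unit scaleC_one)
  have \<Phi>_rank_one: "\<exists>p q. norm p = 1 \<and> norm q = 1 \<and> \<Phi> (rank_one k h) = rank_one p q"
    if "norm k = 1" "norm h = 1" for k h
    using image rank_one_minimal_tripotent[OF that] by (metis imageI minimal_tripotent_rank_one)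
  have F_nonzero: "\<exists>p q. norm p = 1 \<and> norm q = 1 \<and> \<Phi> (rank_one (sgn k) (sgn h)) = rank_one p q \<and>
      F k h = rank_one (complex_of_real (norm k * norm h) *\<^sub>C p) q" if "k \<noteq> 0" "h \<noteq> 0" for k h
    using \<Phi>_rank_one[of "sgn k" "sgn h"] that
    by (auto simp: F_def norm_sgn rank_one_scaleC_left)
  have F_zero: "F k h = 0" if "k = 0 \<or> h = 0" for k h
    using that by (auto simp: F_def complex_vector.scale_zero_left)
  have id: "rank_one_family id F"
  proof
    show "\<exists>a b. F k h = rank_one a b" for k h
    proof (cases "k = 0 \<or> h = 0")
      case True
      then show ?thesis using F_zero by (intro exI[of _ 0]) simp
    qed (use F_nonzero in blast)
    show "\<exists>k h. F k h = rank_one a b" for a b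
    proof (cases "a = 0 \<or> b = 0")
      case True
      then show ?thesis using F_zero[of 0 0] by (intro exI[of _ 0]) auto
    next
      case False
      then have "rank_one (sgn a) (sgn b) \<in> \<Phi> ` minimal_tripotents"
        unfolding image by (intro rank_one_minimal_tripotent) (simp_all add: norm_sgn)
      then obtain k h where kh: "norm k = 1" "norm h = 1" "rank_one (sgn a) (sgn b) = \<Phi> (rank_one k h)"
        by (metis imageE minimal_tripotent_rank_one)
      define n where "n = norm a * norm b"
      have "n > 0" using False by (simp add: n_def)
      \<comment> \<open>The first argument absorbs both norms of \<open>a\<close> and
        \<open>b\<close>.\<close>
      define k' where "k' = complex_of_real n *\<^sub>C k"
      have "norm k' = n" "sgn k' = k"
        using \<open>n > 0\<close> kh by (simp_all add: k'_def norm_scaleC sgn_div_norm scaleR_eq_scaleC scaleC_scaleC scaleC_one)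
      then have "F k' h = rank_one a b"
        using kh by (simp add: F_def sgn_unit rank_one_normalize[of a b] n_def)
      then show ?thesis by blast
    qed
    show "cinner a a' * cinner b' b = id (cinner k k' * cinner h' h)"
      if F: "F k h = rank_one a b" and F': "F k' h' = rank_one a' b'" for k h k' h' a b a' b'
    proof (cases "k = 0 \<or> h = 0 \<or> k' = 0 \<or> h' = 0")
      case True
      then have "rank_one a b = 0 \<or> rank_one a' b' = 0" using F F' F_zero by metis
      then show ?thesis using True by (auto simp: rank_one_eq_0)
    next
      case False
      define n n' where "n = complex_of_real (norm k * norm h)" and "n' = complex_of_real (norm k' * norm h')"
      obtain p q where pq: "norm p = 1" "norm q = 1" "\<Phi> (rank_one (sgn k) (sgn h)) = rank_one p q"
        "rank_one a b = rank_one (n *\<^sub>C p) q"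
        using F_nonzero[of k h] False F by (auto simp: n_def)
      obtain r s where rs: "norm r = 1" "norm s = 1" "\<Phi> (rank_one (sgn k') (sgn h')) = rank_one r s"
        "rank_one a' b' = rank_one (n' *\<^sub>C r) s"
        using F_nonzero[of k' h'] False F' by (auto simp: n'_def)
      have min: "rank_one (sgn k) (sgn h) \<in> minimal_tripotents" "rank_one (sgn k') (sgn h') \<in> minimal_tripotents"
        by (intro rank_one_minimal_tripotent; use False in \<open>simp add: norm_sgn\<close>)+
      then have "TTP (rank_one p q) (rank_one r s) = TTP (rank_one (sgn k) (sgn h)) (rank_one (sgn k') (sgn h'))"
        using assms(6) pq rs by metis
      then have ttp: "cinner s q * cinner p r = cinner (sgn h') (sgn h) * cinner (sgn k) (sgn k')"
        using False rs by (simp add: TTP_rank_one norm_sgn cinner_scaleC_left)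
      \<comment> \<open>The pairing depends only on the operators and not on the vectors that
        represent them, so \<open>a\<close>, \<open>b\<close> may be replaced by the normalized
        representation.\<close>
      have pair: "cinner x x' * cinner y' y = cinner u u' * cinner w' w"
        if "rank_one x y = rank_one u w" "rank_one x' y' = rank_one u' w'"
        for x u x' u' :: 'k2 and y w y' w' :: 'h2
      proof -
        have "cinner x x' * cinner y' y = cinner (rank_one x y *\<^sub>V y') x'"
          by (simp add: cinner_scaleC_left mult.commute)
        also have "\<dots> = cinner u (rank_one x' y' *\<^sub>V w)"
          by (simp add: that(1) cinner_simps cinner_commute[of w] mult.commute)
        also have "\<dots> = cinner u u' * cinner w' w"
          by (simp add: that(2) cinner_simps cinner_commute[of w'] mult.commute)
        finally show ?thesis .
      qed
      have "cinner a a' * cinner b' b = cinner (n *\<^sub>C p) (n' *\<^sub>C r) * cinner s q"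
        by (rule pair[OF pq(4) rs(4)])
      also have "\<dots> = n * n' * (cinner s q * cinner p r)"
        by (simp add: cinner_simps n'_def mult_ac)
      also have "\<dots> = cinner k k' * cinner h' h"
        using False by (simp add: ttp n_def n'_def cinner_sgn cinner_sgn_right)
      finally show ?thesis by simp
    qed
  qed simp
  obtain k0 k1 :: 'k1 where k: "norm k0 = 1" "norm k1 = 1" "cinner k0 k1 = 0"
    using orthonormal_pair[OF assms(2)] .
  obtain h0 h1 :: 'h1 where h: "norm h0 = 1" "norm h1 = 1" "cinner h0 h1 = 0"
    using orthonormal_pair[OF assms(1)] .
  obtain a0 b0 where ab0: "norm a0 = 1" "norm b0 = 1" "F k0 h0 = rank_one a0 b0"
    using \<Phi>_rank_one[of k0 h0] k h F_unit by metis
  obtain a1 b1 where ab1: "norm a1 = 1" "norm b1 = 1" "F k0 h1 = rank_one a1 b1"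
    using \<Phi>_rank_one[of k0 h1] k h F_unit by metis
  have "\<exists>T. triple_isomorphism T \<and> (\<forall>k h. T (rank_one k h) = F k h)"
  proof -
    interpret F: rank_one_family id F by (rule id)
    interpret F': rank_one_family cnj "\<lambda>k h. adj (F k h)" by (rule rank_one_family_adj[OF id])
    \<comment> \<open>This alternative decides whether \<open>\<Phi>\<close> keeps or exchanges the
      two factors.\<close>
    have "(\<exists>c. a1 = c *\<^sub>C a0) \<or> (\<exists>c. b1 = c *\<^sub>C b0)"
      by (rule F.adjacent_left[OF ab0(3) _ _ ab1(3)]) (use ab0 in auto)
    then show ?thesis
    proof (elim disjE exE)
      fix c assume "a1 = c *\<^sub>C a0"
      then have "F k0 h1 = rank_one a0 (cnj c *\<^sub>C b1)"
        by (simp add: ab1 rank_one_scaleC_left rank_one_scaleC_right)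
      then obtain g f where gf: "F.unitary g" "F.unitary f" "\<And>k h. F k h = rank_one (g k) (f h)"
        using F.factorization[OF k(1) h(1) k(2) h(2) k(3) h(3) ab0(1,3)] by blast
      obtain S :: "('h1 \<Rightarrow>\<^sub>C\<^sub>L 'k1) \<Rightarrow> ('h2 \<Rightarrow>\<^sub>C\<^sub>L 'k2)"
        where "\<And>x h. S x *\<^sub>V f h = g (x *\<^sub>V h)"
        using F.unitary_conjugation[OF gf(2,1)] by blast
      note S = F.unitary_conjugation_properties[OF gf(2,1) this]
      have "Vector_Spaces.linear scaleC scaleC S"
        by unfold_locales (simp_all add: S scaleC_add_right scaleC_add_left scaleC_scaleC scaleC_one)
      then have "triple_isomorphism S"
        unfolding triple_isomorphism_def using S by blast
      then show ?thesis using S(5) gf(3) by metis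
    next
      fix c assume "b1 = c *\<^sub>C b0"
      then have "adj (F k0 h1) = rank_one b0 (cnj c *\<^sub>C a1)"
        by (simp add: ab1 rank_one_scaleC_left rank_one_scaleC_right adj_scaleC)
      moreover have "adj (F k0 h0) = rank_one b0 a0" by (simp add: ab0)
      ultimately obtain g f where gf: "F'.unitary g" "F'.unitary f"
          "\<And>k h. adj (F k h) = rank_one (g k) (f h)"
        using F'.factorization[OF k(1) h(1) k(2) h(2) k(3) h(3) ab0(2)] by blast
      obtain S :: "('h1 \<Rightarrow>\<^sub>C\<^sub>L 'k1) \<Rightarrow> ('k2 \<Rightarrow>\<^sub>C\<^sub>L 'h2)"
        where "\<And>x h. S x *\<^sub>V f h = g (x *\<^sub>V h)"
        using F'.unitary_conjugation[OF gf(2,1)] by blast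
      note S = F'.unitary_conjugation_properties[OF gf(2,1) this]
      \<comment> \<open>\<open>S\<close> and \<open>adj\<close> are both conjugate-linear, so their
        composite is linear; both respect the triple product.\<close>
      define T where "T x = adj (S x)" for x
      have "Vector_Spaces.linear scaleC scaleC T"
        by unfold_locales
          (simp_all add: T_def S adj_add adj_scaleC scaleC_add_right scaleC_add_left scaleC_scaleC scaleC_one)
      moreover have "bij (adj :: ('k2 \<Rightarrow>\<^sub>C\<^sub>L 'h2) \<Rightarrow> _)" by (rule o_bij[of adj]) auto
      then have "bij T" using bij_comp[OF S(3)] by (simp add: T_def[abs_def] comp_def)
      moreover have "T (triple x y z) = triple (T x) (T y) (T z)" for x y z
        by (simp add: T_def S(4) adj_triple)
      ultimately have "triple_isomorphism T" unfolding triple_isomorphism_def by blast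
      moreover have "T (rank_one k h) = F k h" for k h
        unfolding T_def S(5) gf(3)[symmetric] by (rule adj_adj)
      ultimately show ?thesis by blast
    qed
  qed
  then obtain T where T: "triple_isomorphism T" "\<And>k h. T (rank_one k h) = F k h" by blast
  have "T e = \<Phi> e" if "e \<in> minimal_tripotents" for e
    using minimal_tripotent_rank_one[OF that] T(2) F_unit by metis
  moreover have "T1 = T2"
    if T1: "triple_isomorphism T1" "\<forall>e \<in> minimal_tripotents. T1 e = \<Phi> e"
      and T2: "triple_isomorphism T2" "\<forall>e \<in> minimal_tripotents. T2 e = \<Phi> e" for T1 T2
  proof
    fix x
    interpret F: rank_one_family id F by (rule id)
    \<comment> \<open>Every \<open>p \<otimes> q\<close> is the image of a minimal tripotent
      \<open>e\<close>, and both isomorphisms carry the functional of \<open>e\<close> to that of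
      \<open>p \<otimes> q\<close>.\<close>
    have *: "cinner (T1 x *\<^sub>V q) p = cinner (T2 x *\<^sub>V q) p" if pq: "norm p = 1" "norm q = 1" for p q
    proof -
      have "rank_one p q \<in> \<Phi> ` minimal_tripotents"
        unfolding image by (rule rank_one_minimal_tripotent[OF pq])
      then obtain e where e: "e \<in> minimal_tripotents" "\<Phi> e = rank_one p q" by auto
      obtain k h where kh: "norm k = 1" "norm h = 1" "e = rank_one k h"
        by (rule minimal_tripotent_rank_one[OF e(1)])
      have "T1 (rank_one k h) = rank_one p q" "T2 (rank_one k h) = rank_one p q"
        using T1(2) T2(2) e kh(3) by auto
      then show ?thesis
        using triple_isomorphism_functional[OF T1(1) kh(1,2) pq]
          triple_isomorphism_functional[OF T2(1) kh(1,2) pq] by simp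
    qed
    show "T1 x = T2 x"
    proof (rule cblinfun_eq_by_cinner)
      fix v u
      show "cinner (T1 x *\<^sub>V v) u = cinner (T2 x *\<^sub>V v) u"
      proof (cases "u = 0 \<or> v = 0")
        case False
        have eq: "cinner (X *\<^sub>V v) u = norm u * norm v * cinner (X *\<^sub>V sgn v) (sgn u)"
          for X :: "'h2 \<Rightarrow>\<^sub>C\<^sub>L 'k2"
        proof -
          have "cinner (X *\<^sub>V v) u
              = cinner (X *\<^sub>V (complex_of_real (norm v) *\<^sub>C sgn v)) (complex_of_real (norm u) *\<^sub>C sgn u)"
            by (simp only: cnormalize)
          then show ?thesis by (simp add: cblinfun_simps cinner_simps mult_ac)
        qed
        show ?thesis using False by (simp only: eq) (simp add: * norm_sgn)
      qed auto
    qed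
  qed
  ultimately show ?thesis using T(1) by blast
qed

end
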